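(* Let $n\geq 1$, let $W_0$ be a finite group, let $\alpha:W_0\to GL_n(\mathbb{Z})$ be an injective homomorphism, and let $W\cong\mathbb{Z}^n\rtimes_\alpha W_0$. Then the complete first-order theory $\mathrm{Th}(W)$ of $W$ in the language of groups does not have a prime model.
   Context: $\mathbb{Z}^n\rtimes_\alpha W_0$ is the (external) semidirect product in which $w\in W_0$ acts on $\mathbb{Z}^n$ via the matrix $\alpha(w)\in GL_n(\mathbb{Z})=\mathrm{Aut}(\mathbb{Z}^n)$, with multiplication $(a,w)(b,v)=(a+\alpha(w)(b),wv)$. A prime model of a complete theory is a model of the theory that embeds elementarily into every model of the theory. *)

theory Defs
  imports "HOL-Analysis.Cartesian_Space" "HOL-Algebra.Group"
begin

text \<open>The dimension n is the cardinality of the finite index type \<open>'n\<close>; it is automatically at least 1.\<close>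

definition GL_int :: "(int ^ 'n ^ 'n) monoid" where
  "GL_int = \<lparr>carrier = {A. invertible A}, mult = (**), one = mat 1\<rparr>"

definition semidirect_int ::
    "'g monoid \<Rightarrow> ('g \<Rightarrow> int ^ 'n ^ 'n) \<Rightarrow> ((int ^ 'n) \<times> 'g) monoid" where
  "semidirect_int W\<^sub>0 \<alpha> =
     \<lparr>carrier = UNIV \<times> carrier W\<^sub>0,
      mult = (\<lambda>(a, w) (b, v). (a + \<alpha> w *v b, w \<otimes>\<^bsub>W\<^sub>0\<^esub> v)),
      one = (0, \<one>\<^bsub>W\<^sub>0\<^esub>)\<rparr>"

datatype gterm = Var nat | One | Inv gterm | Mul gterm gterm

datatype gformula =
    Eq gterm gterm
  | Neg gformula
  | Conj gformula gformula
  | Ex nat gformula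

primrec term_vars :: "gterm \<Rightarrow> nat set" where
  "term_vars (Var x) = {x}"
| "term_vars One = {}"
| "term_vars (Inv t) = term_vars t"
| "term_vars (Mul s t) = term_vars s \<union> term_vars t"

primrec free_vars :: "gformula \<Rightarrow> nat set" where
  "free_vars (Eq s t) = term_vars s \<union> term_vars t"
| "free_vars (Neg p) = free_vars p"
| "free_vars (Conj p q) = free_vars p \<union> free_vars q"
| "free_vars (Ex x p) = free_vars p - {x}"

definition sentence :: "gformula \<Rightarrow> bool" where
  "sentence p \<longleftrightarrow> free_vars p = {}"

text \<open>A structure interprets the symbols for multiplication, neutral element and inversion
  arbitrarily; it need not be a group.\<close>

record 'a gstruct = "'a monoid" +
  inv_op :: "'a \<Rightarrow> 'a"

definition is_struct :: "'a gstruct \<Rightarrow> bool" where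
  "is_struct M \<longleftrightarrow>
     \<one>\<^bsub>M\<^esub> \<in> carrier M \<and>
     (\<forall>a\<in>carrier M. inv_op M a \<in> carrier M) \<and>
     (\<forall>a\<in>carrier M. \<forall>b\<in>carrier M. a \<otimes>\<^bsub>M\<^esub> b \<in> carrier M)"

definition struct_of_group :: "'a monoid \<Rightarrow> 'a gstruct" where
  "struct_of_group G =
     \<lparr>carrier = carrier G, mult = mult G, one = \<one>\<^bsub>G\<^esub>, inv_op = m_inv G\<rparr>"

primrec term_val :: "'a gstruct \<Rightarrow> (nat \<Rightarrow> 'a) \<Rightarrow> gterm \<Rightarrow> 'a" where
  "term_val M e (Var x) = e x"
| "term_val M e One = \<one>\<^bsub>M\<^esub>"
| "term_val M e (Inv t) = inv_op M (term_val M e t)"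
| "term_val M e (Mul s t) = term_val M e s \<otimes>\<^bsub>M\<^esub> term_val M e t"

primrec sat :: "'a gstruct \<Rightarrow> (nat \<Rightarrow> 'a) \<Rightarrow> gformula \<Rightarrow> bool" where
  "sat M e (Eq s t) \<longleftrightarrow> term_val M e s = term_val M e t"
| "sat M e (Neg p) \<longleftrightarrow> \<not> sat M e p"
| "sat M e (Conj p q) \<longleftrightarrow> sat M e p \<and> sat M e q"
| "sat M e (Ex x p) \<longleftrightarrow> (\<exists>a\<in>carrier M. sat M (e(x := a)) p)"

definition holds :: "'a gstruct \<Rightarrow> gformula \<Rightarrow> bool" where
  "holds M p \<longleftrightarrow> (\<forall>e. range e \<subseteq> carrier M \<longrightarrow> sat M e p)"

definition Th :: "'a gstruct \<Rightarrow> gformula set" where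
  "Th M = {p. sentence p \<and> holds M p}"

definition is_model :: "'a gstruct \<Rightarrow> gformula set \<Rightarrow> bool" where
  "is_model M T \<longleftrightarrow> is_struct M \<and> (\<forall>p\<in>T. holds M p)"

definition elementary_embedding :: "('a \<Rightarrow> 'b) \<Rightarrow> 'a gstruct \<Rightarrow> 'b gstruct \<Rightarrow> bool" where
  "elementary_embedding f M N \<longleftrightarrow>
     f ` carrier M \<subseteq> carrier N \<and>
     (\<forall>p e. range e \<subseteq> carrier M \<longrightarrow> (sat M e p \<longleftrightarrow> sat N (f \<circ> e) p))"

text \<open>HOL cannot quantify over all types inside a formula, so the type \<open>'u\<close> in which the target
  models live is a parameter. A prime model in the usual sense is prime relative to every
  \<open>'u\<close>. Relative to a type too small to carry any model of \<open>T\<close> the second conjunct would be vacuous,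
  hence \<open>'u\<close> should be infinite when \<open>T\<close> is the theory of an infinite countable structure.\<close>

definition prime_model :: "'u itself \<Rightarrow> gformula set \<Rightarrow> 'm gstruct \<Rightarrow> bool" where
  "prime_model U T M \<longleftrightarrow>
     is_model M T \<and>
     (\<forall>N :: 'u gstruct. is_model N T \<longrightarrow> (\<exists>f. elementary_embedding f M N))"

end

theory Submission
  imports Defs "HOL-Number_Theory.Cong" "HOL-Algebra.Multiplicative_Group"
begin

text \<open>All structures \<open>A\<^sup>n \<rtimes> W\<^sub>0\<close>, where \<open>A\<close> is a nonzero pure subgroup of
  \<open>\<Prod>\<^sub>p \<int>\<^sub>(\<^sub>p\<^sub>)\<close> with \<open>A + dP = P\<close> for the full product \<open>P\<close> and all \<open>d > 0\<close>, are elementarily equivalent;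
  this covers the diagonal copy of \<open>\<int>\<close> and the direct sum \<open>H = \<Oplus>\<^sub>p \<int>\<^sub>(\<^sub>p\<^sub>)\<close>. A prime model would
  embed elementarily into \<open>\<int>\<^sup>n \<rtimes> W\<^sub>0\<close> and into \<open>H\<^sup>n \<rtimes> W\<^sub>0\<close>. With \<open>k = |W\<^sub>0|\<close> it contains some \<open>x\<close> with
  \<open>x\<^sup>k \<noteq> 1\<close>. In the first structure \<open>x\<^sup>k\<close> is a nonzero integer vector, which has no \<open>m\<close>-th root for
  large \<open>m\<close>; in the second it has finite support, hence an \<open>m\<close>-th root for every large prime \<open>m\<close>.\<close>

section \<open>Pure dense subgroups of the product of the localizations of the integers\<close>

text \<open>Purity and density give A/dA = P/dP for every d > 0: residues can be matched between any
  two such groups, and linear equations with a solution in P over parameters from A have one in A.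
  The obstacle is that the two structures compared are countable and not isomorphic, so no infinite
  back-and-forth between them can succeed. Each formula therefore receives numbers L and D before
  groups and assignments are chosen, and only integer relations with coefficients up to L and
  residues modulo D are matched. The twisted multiplication fits into this scheme because matched
  variables keep the same part in the finite group: a word then becomes the same integer linear form
  on both sides, with coefficients bounded independently of that part.

  The opposite behaviour of roots comes from the fact that every prime other than p is a unit in the
  localization at p. Raising to the power k makes every element a translation, which turns a
  statement about vectors into one about group words. Both structures are countable, so they can be
  copied into any infinite type \<open>'u\<close>, the only place where primality provides
  embeddings.\<close>

definition localized_int :: "nat \<Rightarrow> rat set" where
  "localized_int p = {of_int a / of_int b | a b. \<not> int p dvd b}"

text \<open>Only the components at primes are constrained; the others are arbitrary rationals, which
  affects neither purity nor density.\<close>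

definition loc_prod :: "(nat \<Rightarrow> rat) set" where
  "loc_prod = {x. \<forall>p. prime p \<longrightarrow> x p \<in> localized_int p}"

lemma localized_intI: "\<not> int p dvd b \<Longrightarrow> of_int a / of_int b \<in> localized_int p"
  unfolding localized_int_def by blast

lemma localized_int_of_int:
  assumes "prime p"
  shows "of_int a \<in> localized_int p"
  using localized_intI[of p 1 a] prime_gt_1_nat[OF assms] by simp

lemma localized_int_add:
  assumes "prime p" "x \<in> localized_int p" "y \<in> localized_int p"
  shows "x + y \<in> localized_int p"
proof -
  obtain a b c d where x: "x = of_int a / of_int b" "\<not> int p dvd b"
    and y: "y = of_int c / of_int d" "\<not> int p dvd d"
    using assms unfolding localized_int_def by blast
  have "b \<noteq> 0" "d \<noteq> 0" using x y by auto
  then have "x + y = of_int (a * d + c * b) / of_int (b * d)"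
    by (simp add: x y add_frac_eq)
  moreover have "\<not> int p dvd b * d"
    using assms(1) x y by (simp add: prime_dvd_mult_iff)
  ultimately show ?thesis using localized_intI by metis
qed

lemma localized_int_mult_of_int:
  assumes "x \<in> localized_int p"
  shows "of_int c * x \<in> localized_int p"
proof -
  obtain a b where x: "x = of_int a / of_int b" "\<not> int p dvd b"
    using assms unfolding localized_int_def by blast
  then show ?thesis using localized_intI[of p b "c * a"] by simp
qed

lemma localized_int_divide:
  assumes "prime p" "x \<in> localized_int p" "\<not> p dvd d"
  shows "x / of_nat d \<in> localized_int p"
proof -
  obtain a b where x: "x = of_int a / of_int b" "\<not> int p dvd b"
    using assms unfolding localized_int_def by blast
  have "\<not> int p dvd b * int d"
    using assms x by (simp add: prime_dvd_mult_iff)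
  then show ?thesis using localized_intI[of p "b * int d" a] x by simp
qed

text \<open>A prime factor of the reduced denominator would contradict membership in the
  localization at that very prime. This supplies the purity of \<open>const_ints\<close>.\<close>

lemma int_if_all_localized:
  fixes q :: rat
  assumes "\<And>p. prime p \<Longrightarrow> q \<in> localized_int p"
  shows "q \<in> \<int>"
proof -
  obtain a b where ab: "quotient_of q = (a, b)" by fastforce
  have b: "b > 0" "coprime a b" and q: "q = of_int a / of_int b"
    using ab quotient_of_denom_pos quotient_of_coprime quotient_of_div by blast+
  have "b = 1"
  proof (rule ccontr)
    assume "b \<noteq> 1"
    then have "nat b \<noteq> 1" using b by auto
    then obtain p where p: "prime p" "p dvd nat b" using prime_factor_nat by blast
    then have pb: "int p dvd b" using b by (simp add: nat_dvd_iff int_dvd_int_iff[symmetric] del: int_dvd_int_iff)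
    obtain c d where cd: "q = of_int c / of_int d" "\<not> int p dvd d"
      using assms[OF p(1)] unfolding localized_int_def by blast
    have "d \<noteq> 0" using cd by auto
    then have "(of_int (a * d) :: rat) = of_int (c * b)" using q cd b by (simp add: frac_eq_eq)
    then have "a * d = c * b" using of_int_eq_iff by blast
    then have "int p dvd a * d" using pb by simp
    then have "int p dvd a" using cd p by (simp add: prime_dvd_mult_iff)
    then have "int p dvd 1" using pb b(2) coprime_common_divisor by blast
    then show False using p by auto
  qed
  then show ?thesis using q by simp
qed

lemma loc_prod_of_int: "(\<lambda>p. of_int n) \<in> loc_prod"
  by (simp add: loc_prod_def localized_int_of_int)

lemma loc_prod_add: "x \<in> loc_prod \<Longrightarrow> y \<in> loc_prod \<Longrightarrow> (\<lambda>p. x p + y p) \<in> loc_prod"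
  by (simp add: loc_prod_def localized_int_add)

lemma loc_prod_scale: "x \<in> loc_prod \<Longrightarrow> (\<lambda>p. of_int c * x p) \<in> loc_prod"
  by (simp add: loc_prod_def localized_int_mult_of_int)

lemma loc_prod_add_scaled:
  "x \<in> loc_prod \<Longrightarrow> y \<in> loc_prod \<Longrightarrow> (\<lambda>p. x p + of_int c * y p) \<in> loc_prod"
  by (simp add: loc_prod_add loc_prod_scale)

text \<open>\<open>dense\<close> makes A meet every coset of dP, and \<open>pure\<close> makes the
  intersection of A with dP equal to dA. \<open>nontrivial\<close> makes A meet each coset
  infinitely often, which leaves room to avoid the solutions of finitely many linear
  relations.\<close>

locale pure_dense =
  fixes A :: "(nat \<Rightarrow> rat) set"
  assumes subset: "x \<in> A \<Longrightarrow> x \<in> loc_prod"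
    and zero: "(\<lambda>p. 0) \<in> A"
    and add: "x \<in> A \<Longrightarrow> y \<in> A \<Longrightarrow> (\<lambda>p. x p + y p) \<in> A"
    and scale: "x \<in> A \<Longrightarrow> (\<lambda>p. of_int c * x p) \<in> A"
    and pure: "x \<in> loc_prod \<Longrightarrow> c \<noteq> 0 \<Longrightarrow> (\<lambda>p. of_int c * x p) \<in> A \<Longrightarrow> x \<in> A"
    and dense: "x \<in> loc_prod \<Longrightarrow> d > 0 \<Longrightarrow>
      \<exists>a\<in>A. \<exists>z\<in>loc_prod. \<forall>p. x p = a p + of_nat d * z p"
    and nontrivial: "\<exists>x\<in>A. \<exists>p. x p \<noteq> 0"

definition lin :: "('k \<Rightarrow> int) \<Rightarrow> 'k set \<Rightarrow> ('k \<Rightarrow> nat \<Rightarrow> rat) \<Rightarrow> nat \<Rightarrow> rat" where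
  "lin c I a = (\<lambda>p. \<Sum>k\<in>I. of_int (c k) * a k p)"

lemma (in pure_dense) sum_mem:
  assumes "finite I" "\<And>k. k \<in> I \<Longrightarrow> f k \<in> A"
  shows "(\<lambda>p. \<Sum>k\<in>I. f k p) \<in> A"
  using assms by (induction I rule: finite_induct) (simp_all add: zero add)

lemma (in pure_dense) lin_mem:
  assumes "finite I" "\<And>k. k \<in> I \<Longrightarrow> a k \<in> A"
  shows "lin c I a \<in> A"
  unfolding lin_def using assms by (intro sum_mem scale) auto

section \<open>The two instances: diagonal integers and finitely supported families\<close>

definition const_ints :: "(nat \<Rightarrow> rat) set" where
  "const_ints = range (\<lambda>n p. of_int n)"

definition fin_supp :: "(nat \<Rightarrow> rat) set" where
  "fin_supp = {x \<in> loc_prod. finite {p. x p \<noteq> 0}}"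

text \<open>Only the component at \<open>q\<close> constrains the integer, since \<open>q\<close> is
  a unit in every other localization. At \<open>q\<close> the fraction a/b is reduced modulo
  \<open>q\<close> by inverting its denominator.\<close>

lemma const_ints_dense_prime:
  assumes "prime q" "x \<in> loc_prod"
  shows "\<exists>n. \<exists>z\<in>loc_prod. \<forall>p. x p = of_int n + of_nat q * z p"
proof -
  obtain a b where ab: "x q = of_int a / of_int b" "\<not> int q dvd b"
    using assms unfolding loc_prod_def localized_int_def by blast
  have b0: "b \<noteq> 0" using ab by auto
  have q0: "(of_nat q :: rat) \<noteq> 0" using assms(1) by auto
  have "coprime b (int q)"
    using prime_imp_coprime[of "int q" b] assms(1) ab(2) by (simp add: coprime_commute)
  then obtain u where "[b * u = 1] (mod int q)" using cong_solve_coprime_int by blast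
  then have "[b * u * a = 1 * a] (mod int q)" using cong_scalar_right by blast
  then have "int q dvd a - b * u * a" by (simp add: cong_iff_dvd_diff dvd_diff_commute)
  then obtain k where k: "a - b * u * a = int q * k" by (elim dvdE)
  define n where "n = u * a"
  define z where "z = (\<lambda>p. (x p - of_int n) / of_nat q)"
  have "z p \<in> localized_int p" if p: "prime p" for p
  proof (cases "p = q")
    case True
    have "a = b * n + int q * k" using k by (simp add: n_def algebra_simps)
    then have "(of_int a :: rat) = of_int b * of_int n + of_nat q * of_int k"
      by (metis of_int_add of_int_mult of_int_of_nat_eq)
    then have "z p = of_int k / of_int b"
      using b0 q0 by (simp add: z_def True ab field_simps)
    then show ?thesis using ab True localized_intI by simp
  next
    case False
    have "x p + of_int (- n) \<in> localized_int p"
      using assms p by (intro localized_int_add localized_int_of_int) (auto simp: loc_prod_def)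
    moreover have "\<not> p dvd q" using p assms(1) False primes_dvd_imp_eq by blast
    ultimately show ?thesis using localized_int_divide[OF p] by (simp add: z_def)
  qed
  then have "z \<in> loc_prod" by (simp add: loc_prod_def)
  moreover have "\<forall>p. x p = of_int n + of_nat q * z p" using q0 by (simp add: z_def)
  ultimately show ?thesis by blast
qed

text \<open>Peels off one prime factor at a time and approximates the remaining quotient
  \<open>z\<close> in turn; counting primes with multiplicity takes the place of Chinese
  remaindering.\<close>

lemma const_ints_dense:
  assumes "d > 0" "x \<in> loc_prod"
  shows "\<exists>n. \<exists>z\<in>loc_prod. \<forall>p. x p = of_int n + of_nat d * z p"
  using assms
proof (induction d arbitrary: x rule: less_induct)
  case (less d)
  show ?case
  proof (cases "d = 1")
    case True
    then show ?thesis using less.prems by (intro exI[of _ 0] bexI[of _ x]) auto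
  next
    case False
    then obtain q where q: "prime q" "q dvd d" using prime_factor_nat by blast
    then obtain d' where d': "d = q * d'" by (elim dvdE)
    obtain n z where z: "z \<in> loc_prod" "\<forall>p. x p = of_int n + of_nat q * z p"
      using const_ints_dense_prime[OF q(1) less.prems(2)] by blast
    have "d' < d" "d' > 0" using d' less.prems(1) q(1) prime_gt_1_nat[of q] by auto
    then obtain n' z' where z': "z' \<in> loc_prod" "\<forall>p. z p = of_int n' + of_nat d' * z' p"
      using less.IH z(1) by blast
    have "\<forall>p. x p = of_int (n + int q * n') + of_nat d * z' p"
      using z(2) z'(2) by (simp add: d' algebra_simps)
    then show ?thesis using z'(1) by blast
  qed
qed

lemma pure_dense_const_ints: "pure_dense const_ints"
proof
  fix x :: "nat \<Rightarrow> rat" and c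
  assume x: "x \<in> loc_prod" "c \<noteq> (0 :: int)" "(\<lambda>p. of_int c * x p) \<in> const_ints"
  then obtain n where "(\<lambda>p. of_int c * x p) = (\<lambda>p. of_int n)" unfolding const_ints_def by blast
  then have "of_int c * x p = of_int n" for p by meson
  then have eq: "x p = of_int n / of_int c" for p using x(2) by (simp add: field_simps)
  have "(of_int n / of_int c :: rat) \<in> \<int>"
    using x(1) eq int_if_all_localized unfolding loc_prod_def by fastforce
  then obtain m where "(of_int n / of_int c :: rat) = of_int m" by (elim Ints_cases)
  then show "x \<in> const_ints" using eq unfolding const_ints_def by auto
next
  fix x :: "nat \<Rightarrow> rat" and d :: nat
  assume "x \<in> loc_prod" "0 < d"
  then show "\<exists>a\<in>const_ints. \<exists>z\<in>loc_prod. \<forall>p. x p = a p + of_nat d * z p"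
    using const_ints_dense unfolding const_ints_def by fastforce
next
  fix x y :: "nat \<Rightarrow> rat" and c
  assume "x \<in> const_ints"
  then obtain n where n: "x = (\<lambda>p. of_int n)" unfolding const_ints_def by blast
  show "x \<in> loc_prod" using loc_prod_of_int n by simp
  have "(\<lambda>p. of_int c * x p) = (\<lambda>p. of_int (c * n))" using n by simp
  then show "(\<lambda>p. of_int c * x p) \<in> const_ints" unfolding const_ints_def by blast
  assume "y \<in> const_ints"
  then obtain m where "y = (\<lambda>p. of_int m)" unfolding const_ints_def by blast
  then have "(\<lambda>p. x p + y p) = (\<lambda>p. of_int (n + m))" using n by simp
  then show "(\<lambda>p. x p + y p) \<in> const_ints" unfolding const_ints_def by blast
next
  show "(\<lambda>p. 0) \<in> const_ints" unfolding const_ints_def by (rule image_eqI[of _ _ 0]) auto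
  show "\<exists>x\<in>const_ints. \<exists>p. x p \<noteq> 0"
    unfolding const_ints_def by (rule bexI[of _ "\<lambda>p. of_int 1"]) (simp, blast)
qed

lemma pure_dense_fin_supp: "pure_dense fin_supp"
proof
  fix x :: "nat \<Rightarrow> rat" and c
  assume "x \<in> loc_prod" "c \<noteq> (0 :: int)" "(\<lambda>p. of_int c * x p) \<in> fin_supp"
  then show "x \<in> fin_supp" by (simp add: fin_supp_def)
next
  fix x :: "nat \<Rightarrow> rat" and d :: nat
  assume x: "x \<in> loc_prod" "0 < d"
  \<comment> \<open>Only the finitely many components at divisors of \<open>d\<close> can resist
    division by \<open>d\<close>; they form the finitely supported part.\<close>
  define h where "h = (\<lambda>p. if p dvd d then x p else 0)"
  define z where "z = (\<lambda>p. if p dvd d then 0 else x p / of_nat d)"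
  have zero_mem: "0 \<in> localized_int p" if "prime p" for p
    using localized_int_of_int[OF that, of 0] by simp
  have "finite {p. p dvd d}" using x(2) by simp
  then have "finite {p. h p \<noteq> 0}" by (rule rev_finite_subset) (auto simp: h_def)
  moreover have "h \<in> loc_prod" using x(1) zero_mem by (auto simp: h_def loc_prod_def)
  ultimately have "h \<in> fin_supp" by (simp add: fin_supp_def)
  moreover have "z \<in> loc_prod"
    using x(1) zero_mem localized_int_divide by (auto simp: z_def loc_prod_def)
  moreover have "\<forall>p. x p = h p + of_nat d * z p" using x(2) by (simp add: h_def z_def)
  ultimately show "\<exists>a\<in>fin_supp. \<exists>z\<in>loc_prod. \<forall>p. x p = a p + of_nat d * z p" by blast
next
  fix x y :: "nat \<Rightarrow> rat" and c
  assume x: "x \<in> fin_supp"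
  then show "x \<in> loc_prod" by (simp add: fin_supp_def)
  have "finite {p. of_int c * x p \<noteq> 0}"
    by (rule finite_subset[of _ "{p. x p \<noteq> 0}"]) (use x in \<open>auto simp: fin_supp_def\<close>)
  then show "(\<lambda>p. of_int c * x p) \<in> fin_supp"
    using x loc_prod_scale by (simp add: fin_supp_def)
  assume y: "y \<in> fin_supp"
  have "finite {p. x p + y p \<noteq> 0}"
    by (rule finite_subset[of _ "{p. x p \<noteq> 0} \<union> {p. y p \<noteq> 0}"])
      (use x y in \<open>auto simp: fin_supp_def\<close>)
  then show "(\<lambda>p. x p + y p) \<in> fin_supp"
    using x y loc_prod_add by (simp add: fin_supp_def)
next
  show "(\<lambda>p. 0) \<in> fin_supp" using loc_prod_of_int[of 0] by (simp add: fin_supp_def)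
  \<comment> \<open>The index 0 is not prime, so \<open>loc_prod\<close> asks nothing of the value
    there.\<close>
  have "(\<lambda>p. if p = 0 then 1 else 0) \<in> fin_supp"
    using localized_int_of_int[of _ 0] by (auto simp: fin_supp_def loc_prod_def)
  then show "\<exists>x\<in>fin_supp. \<exists>p. x p \<noteq> 0" by (rule bexI[rotated]) auto
qed

text \<open>An element is a finite list of initial values padded with zeros. Countability is what
  later allows a copy of the structure inside an arbitrary infinite type.\<close>

lemma countable_fin_supp: "countable fin_supp"
proof -
  have "fin_supp \<subseteq> range (\<lambda>(l :: rat list) i. if i < length l then l ! i else 0)" (is "_ \<subseteq> range ?f")
  proof
    fix x assume "x \<in> fin_supp"
    then have "finite {p. x p \<noteq> 0}" by (simp add: fin_supp_def)
    then obtain N where N: "\<And>p. x p \<noteq> 0 \<Longrightarrow> p < N"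
      using finite_nat_set_iff_bounded by auto
    have "x = ?f (map x [0..<N])" using N by fastforce
    then show "x \<in> range ?f" by blast
  qed
  then show ?thesis by (rule countable_subset) auto
qed

lemma countable_const_ints: "countable const_ints"
  by (simp add: const_ints_def)

section \<open>Back-and-forth for pure dense subgroups\<close>

text \<open>A finite-round back-and-forth: congruence modulo \<open>D\<close> together with equality of all integer
  linear relations with coefficients of absolute value at most \<open>L\<close>.\<close>

definition similar ::
    "nat \<Rightarrow> nat \<Rightarrow> 'k set \<Rightarrow> ('k \<Rightarrow> nat \<Rightarrow> rat) \<Rightarrow> ('k \<Rightarrow> nat \<Rightarrow> rat) \<Rightarrow> bool" where
  "similar L D I a b \<longleftrightarrow>
     (\<forall>k\<in>I. \<exists>z\<in>loc_prod. \<forall>p. a k p = b k p + of_nat D * z p) \<and>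
     (\<forall>c. (\<forall>k. \<bar>c k\<bar> \<le> int L) \<longrightarrow> (lin c I a = (\<lambda>p. 0) \<longleftrightarrow> lin c I b = (\<lambda>p. 0)))"

lemma similar_relation_iff:
  assumes "similar L D I a b" "\<And>k. \<bar>c k\<bar> \<le> int L"
  shows "lin c I a = (\<lambda>p. 0) \<longleftrightarrow> lin c I b = (\<lambda>p. 0)"
proof -
  have "\<forall>c. (\<forall>k. \<bar>c k\<bar> \<le> int L) \<longrightarrow> (lin c I a = (\<lambda>p. 0) \<longleftrightarrow> lin c I b = (\<lambda>p. 0))"
    using assms(1) by (simp add: similar_def)
  then show ?thesis using assms(2) by (elim allE[of _ c]) blast
qed

lemma similar_empty: "similar L D {} a b"
  by (simp add: similar_def lin_def)

lemma lin_insert: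
  assumes "finite I" "k \<notin> I"
  shows "lin c (insert k I) a p = of_int (c k) * a k p + lin c I a p"
  using assms by (simp add: lin_def)

lemma lin_cong:
  assumes "\<And>k. k \<in> I \<Longrightarrow> a k = b k" "\<And>k. k \<in> I \<Longrightarrow> c k = d k"
  shows "lin c I a = lin d I b"
  unfolding lin_def using assms by (intro ext sum.cong) auto

lemma lin_add_scaled:
  "lin (\<lambda>k. m * c k + n * d k) I a p = of_int m * lin c I a p + of_int n * lin d I a p"
  by (simp add: lin_def sum_distrib_left sum.distrib algebra_simps)

text \<open>A relation over the smaller index set is padded with zero coefficients, and a congruence
  modulo \<open>D'\<close> implies one modulo its divisor \<open>D\<close>.\<close>

lemma similar_mono:
  fixes a b :: "'a \<Rightarrow> nat \<Rightarrow> rat"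
  assumes "similar L' D' I' a b" "L \<le> L'" "D dvd D'" "I \<subseteq> I'" "finite I'"
  shows "similar L D I a b"
  unfolding similar_def
proof (intro conjI ballI allI impI)
  fix k assume "k \<in> I"
  then obtain z where z: "z \<in> loc_prod" "\<forall>p. a k p = b k p + of_nat D' * z p"
    using assms(1,4) unfolding similar_def by blast
  obtain t where "D' = D * t" using assms(3) by (elim dvdE)
  then show "\<exists>z\<in>loc_prod. \<forall>p. a k p = b k p + of_nat D * z p"
    using z loc_prod_scale[OF z(1), of "int t"]
    by (intro bexI[of _ "\<lambda>p. of_int (int t) * z p"]) auto
next
  fix c :: "'a \<Rightarrow> int" assume c: "\<forall>k. \<bar>c k\<bar> \<le> int L"
  define c' where "c' = (\<lambda>k. if k \<in> I then c k else 0)"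
  have "lin c' I' x = lin c I x" for x
    unfolding lin_def
    by (intro ext sum.mono_neutral_cong_right) (use assms in \<open>auto simp: c'_def\<close>)
  moreover have "\<forall>k. \<bar>c' k\<bar> \<le> int L'"
  proof
    fix k show "\<bar>c' k\<bar> \<le> int L'" using spec[OF c, of k] assms(2) by (auto simp: c'_def)
  qed
  then have "lin c' I' a = (\<lambda>p. 0) \<longleftrightarrow> lin c' I' b = (\<lambda>p. 0)"
    using assms(1) unfolding similar_def by blast
  ultimately show "lin c I a = (\<lambda>p. 0) \<longleftrightarrow> lin c I b = (\<lambda>p. 0)" by simp
qed

lemma similar_sym:
  fixes a b :: "'a \<Rightarrow> nat \<Rightarrow> rat"
  assumes "similar L D I a b"
  shows "similar L D I b a"
  unfolding similar_def
proof (intro conjI ballI allI impI)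
  fix k assume "k \<in> I"
  then obtain z where z: "z \<in> loc_prod" "\<forall>p. a k p = b k p + of_nat D * z p"
    using assms unfolding similar_def by blast
  then show "\<exists>z\<in>loc_prod. \<forall>p. b k p = a k p + of_nat D * z p"
    using loc_prod_scale[OF z(1), of "-1"]
    by (intro bexI[of _ "\<lambda>p. of_int (- 1) * z p"]) auto
next
  fix c :: "'a \<Rightarrow> int" assume "\<forall>k. \<bar>c k\<bar> \<le> int L"
  then show "lin c I b = (\<lambda>p. 0) \<longleftrightarrow> lin c I a = (\<lambda>p. 0)"
    using assms unfolding similar_def by blast
qed

text \<open>If \<open>x\<close> satisfies a relation of size \<open>L\<close> over \<open>a\<close>,
  the match is forced: it must solve the same relation over \<open>b\<close>. The congruence modulo
  \<open>D * fact L\<close> puts this solution into the product, and purity puts it into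
  \<open>A\<close>; eliminating \<open>x\<close> reduces all other relations to ones of size
  \<open>2 * L * L\<close> among the old entries. If there is no such relation, density offers
  infinitely many candidates, of which finitely many are bad.\<close>

lemma (in pure_dense) similar_step:
  fixes a b :: "'k \<Rightarrow> nat \<Rightarrow> rat"
  assumes fin: "finite I" and k0: "k0 \<notin> I"
    and b: "\<And>k. k \<in> I \<Longrightarrow> b k \<in> A"
    and x: "x \<in> loc_prod" and D: "D > 0"
    and sim: "similar (2 * L * L) (D * fact L) I a b"
  shows "\<exists>y\<in>A. similar L D (insert k0 I) (a(k0 := x)) (b(k0 := y))"
proof -
  define dep :: "('k \<Rightarrow> int) \<Rightarrow> int \<Rightarrow> bool" where
    "dep c c0 \<longleftrightarrow> c0 \<noteq> 0 \<and> \<bar>c0\<bar> \<le> int L \<and> (\<forall>k. \<bar>c k\<bar> \<le> int L)" for c c0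
  have lin_upd: "lin c (insert k0 I) (f(k0 := v)) p = of_int (c k0) * v p + lin c I f p"
    for c v p and f :: "'k \<Rightarrow> nat \<Rightarrow> rat"
  proof -
    have "lin c I (f(k0 := v)) = lin c I f" using k0 by (intro lin_cong) auto
    then show ?thesis using lin_insert[OF fin k0, of c "f(k0 := v)" p] by simp
  qed
  have LL: "L \<le> 2 * L * L" by (cases L) auto
  have simL: "similar L D I a b" using similar_mono[OF sim LL _ subset_refl fin] by simp
  have rel: "lin c I a = (\<lambda>p. 0) \<longleftrightarrow> lin c I b = (\<lambda>p. 0)" if "\<And>k. \<bar>c k\<bar> \<le> int (2 * L * L)" for c
    using sim that unfolding similar_def by blast
  have res: "similar L D (insert k0 I) (a(k0 := x)) (b(k0 := y))"
    if y: "\<exists>z\<in>loc_prod. \<forall>p. x p = y p + of_nat D * z p"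
      and eq: "\<And>c. \<forall>k. \<bar>c k\<bar> \<le> int L \<Longrightarrow>
        (\<forall>p. of_int (c k0) * x p + lin c I a p = 0) \<longleftrightarrow> (\<forall>p. of_int (c k0) * y p + lin c I b p = 0)"
    for y
    unfolding similar_def
  proof (intro conjI ballI allI impI)
    fix k assume "k \<in> insert k0 I"
    then show "\<exists>z\<in>loc_prod. \<forall>p. (a(k0 := x)) k p = (b(k0 := y)) k p + of_nat D * z p"
      using y simL k0 unfolding similar_def by (cases "k = k0") auto
  next
    fix c :: "'k \<Rightarrow> int" assume "\<forall>k. \<bar>c k\<bar> \<le> int L"
    then show "lin c (insert k0 I) (a(k0 := x)) = (\<lambda>p. 0)
        \<longleftrightarrow> lin c (insert k0 I) (b(k0 := y)) = (\<lambda>p. 0)"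
      using eq unfolding fun_eq_iff lin_upd by simp
  qed
  show ?thesis
  proof (cases "\<exists>c c0. dep c c0 \<and> (\<forall>p. of_int c0 * x p + lin c I a p = 0)")
    case True
    then obtain c c0 where dep: "dep c c0" and cx: "\<And>p. of_int c0 * x p + lin c I a p = 0"
      by blast
    have c0: "c0 \<noteq> 0" "\<bar>c0\<bar> \<le> int L" and c: "\<And>k. \<bar>c k\<bar> \<le> int L" using dep by (auto simp: dep_def)
    have "nat \<bar>c0\<bar> dvd fact L" using c0 by (intro dvd_fact) auto
    then have "c0 dvd int (fact L)" by (simp only: nat_abs_dvd_iff)
    \<comment> \<open>Every admissible leading coefficient divides \<open>fact L\<close>, so a
      modulus fixed in advance serves whichever relation occurs.\<close>
    then obtain t where t: "int (fact L) = c0 * t" by (elim dvdE)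
    have "\<forall>k\<in>I. \<exists>z\<in>loc_prod. \<forall>p. a k p = b k p + of_nat (D * fact L) * z p"
      using sim unfolding similar_def by blast
    then obtain z where z: "\<And>k. k \<in> I \<Longrightarrow> z k \<in> loc_prod"
      "\<And>k p. k \<in> I \<Longrightarrow> a k p = b k p + of_nat (D * fact L) * z k p" by metis
    have fact: "(of_nat (D * fact L) :: rat) = of_nat D * of_int c0 * of_int t"
      using arg_cong[OF t, of "of_int :: int \<Rightarrow> rat"] by simp
    define s where "s = (\<lambda>p. lin c I z p)"
    have sI: "s \<in> loc_prod"
    proof -
      have "lin c I' z \<in> loc_prod" if "I' \<subseteq> I" for I'
        using finite_subset[OF that fin] that
      proof (induction I' rule: finite_induct)
        case empty
        then show ?case using loc_prod_of_int[of 0] by (simp add: lin_def)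
      next
        case (insert k J)
        then have "(\<lambda>p. of_int (c k) * z k p + lin c J z p) \<in> loc_prod"
          by (intro loc_prod_add loc_prod_scale z) auto
        then show ?case using insert.hyps by (simp add: lin_def)
      qed
      then show ?thesis by (simp add: s_def)
    qed
    have lin_ab: "lin c I a p = lin c I b p + of_nat D * of_int c0 * of_int t * s p" for p
    proof -
      have "lin c I a p = (\<Sum>k\<in>I. of_int (c k) * b k p + of_nat D * of_int c0 * of_int t * (of_int (c k) * z k p))"
        unfolding lin_def
      proof (intro sum.cong refl)
        fix k assume "k \<in> I"
        then have "a k p = b k p + of_nat D * of_int c0 * of_int t * z k p"
          using z(2) fact by simp
        then show "of_int (c k) * a k p
            = of_int (c k) * b k p + of_nat D * of_int c0 * of_int t * (of_int (c k) * z k p)"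
          by (simp add: algebra_simps)
      qed
      then show ?thesis by (simp add: lin_def s_def sum.distrib sum_distrib_left)
    qed
    \<comment> \<open>Replacing \<open>a\<close> by \<open>b\<close> changes the linear form by D *
      c0 * t * s, so shifting \<open>x\<close> by D * t * s restores the relation. The factor
      \<open>D\<close> keeps \<open>y\<close> congruent to \<open>x\<close>.\<close>
    define y where "y = (\<lambda>p. x p + of_int (int D * t) * s p)"
    have y_loc: "y \<in> loc_prod" unfolding y_def using x sI by (rule loc_prod_add_scaled)
    have cy: "of_int c0 * y p + lin c I b p = 0" for p
      using cx[of p] lin_ab[of p] by (simp add: y_def algebra_simps)
    have "lin (\<lambda>k. - c k) I b \<in> A" using fin b by (rule lin_mem)
    moreover have "lin (\<lambda>k. - c k) I b = (\<lambda>p. of_int c0 * y p)"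
    proof
      fix p
      have "lin (\<lambda>k. - c k) I b p = - lin c I b p" by (simp add: lin_def sum_negf)
      then show "lin (\<lambda>k. - c k) I b p = of_int c0 * y p" using cy[of p] by (simp add: add_eq_0_iff)
    qed
    ultimately have yA: "y \<in> A" using pure[OF y_loc c0(1)] by simp
    have "similar L D (insert k0 I) (a(k0 := x)) (b(k0 := y))"
    proof (rule res)
      have "\<forall>p. x p = y p + of_nat D * (of_int (- t) * s p)"
        by (simp add: y_def)
      then show "\<exists>z\<in>loc_prod. \<forall>p. x p = y p + of_nat D * z p"
        using loc_prod_scale[OF sI, of "- t"] by (rule bexI[of _ "\<lambda>p. of_int (- t) * s p"])
    next
      fix e :: "'k \<Rightarrow> int" assume e: "\<forall>k. \<bar>e k\<bar> \<le> int L"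
      \<comment> \<open>Eliminates the new entry between the relations \<open>e\<close> and
        \<open>c\<close>. Each coefficient is a difference of two products of size at most L * L,
        the source of the bound \<open>2 * L * L\<close>.\<close>
      define d where "d = (\<lambda>k. c0 * e k + (- e k0) * c k)"
      have bound: "\<bar>d k\<bar> \<le> int (2 * L * L)" for k
      proof -
        have "\<bar>c0 * e k\<bar> \<le> int L * int L" "\<bar>e k0 * c k\<bar> \<le> int L * int L"
          unfolding abs_mult using e c c0 by (auto intro!: mult_mono)
        then show ?thesis unfolding d_def by auto
      qed
      have key: "(\<forall>p. of_int (e k0) * v p + lin e I f p = 0) \<longleftrightarrow> lin d I f = (\<lambda>p. 0)"
        if "\<And>p. of_int c0 * v p + lin c I f p = 0" for v f
      proof -
        have "lin d I f p = of_int c0 * (of_int (e k0) * v p + lin e I f p)" for p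
        proof -
          have "lin c I f p = - (of_int c0 * v p)" using that[of p] by (simp add: add_eq_0_iff)
          then show ?thesis unfolding d_def lin_add_scaled by (simp add: algebra_simps)
        qed
        then show ?thesis using c0(1) by (simp add: fun_eq_iff)
      qed
      show "(\<forall>p. of_int (e k0) * x p + lin e I a p = 0) \<longleftrightarrow> (\<forall>p. of_int (e k0) * y p + lin e I b p = 0)"
        unfolding key[of x a, OF cx] key[of y b, OF cy] by (rule rel) (rule bound)
    qed
    then show ?thesis using yA by blast
  next
    case False
    obtain y0 z where y0: "y0 \<in> A" "z \<in> loc_prod" "\<And>p. x p = y0 p + of_nat D * z p"
      using dense[OF x D] by blast
    obtain h q where h: "h \<in> A" "h q \<noteq> 0" using nontrivial by blast
    \<comment> \<open>Infinitely many candidates, all congruent to \<open>x\<close> modulo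
      \<open>D\<close>; they differ at the index \<open>q\<close>, where \<open>h\<close> does not
      vanish.\<close>
    define y where "y = (\<lambda>j :: nat. \<lambda>p. y0 p + of_int (int D * int j) * h p)"
    have yA: "y j \<in> A" for j unfolding y_def by (rule add[OF y0(1) scale[OF h(1)]])
    have "inj y"
    proof
      fix i j assume "y i = y j"
      then have "y i q = y j q" by simp
      then show "i = j" using h(2) D by (simp add: y_def)
    qed
    \<comment> \<open>Extensional functions on \<open>I\<close> make the set of relations finite.
      The value c0 = 0 is included too and, as division by zero yields 0, merely adds the zero
      family to \<open>bad\<close>.\<close>
    define C where "C = {- int L..int L} \<times> (I \<rightarrow>\<^sub>E {- int L..int L})"
    define bad where "bad = (\<lambda>(c0, c). \<lambda>p. - lin c I b p / of_int c0) ` C"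
    have "finite C" unfolding C_def using fin finite_PiE[of I "\<lambda>_. {- int L..int L}"] by simp
    then have "finite bad" by (simp add: bad_def)
    moreover have "infinite (range y)" using \<open>inj y\<close> by (simp add: finite_image_iff)
    ultimately have "\<not> range y \<subseteq> bad" by (auto dest: finite_subset)
    then obtain j where j: "y j \<notin> bad" by blast
    have indep: "\<not> (\<forall>p. of_int c0 * y j p + lin c I b p = 0)" if "dep c c0" for c c0
    proof
      assume eq: "\<forall>p. of_int c0 * y j p + lin c I b p = 0"
      have lin_eq: "lin (restrict c I) I b = lin c I b" by (intro lin_cong) auto
      have "y j = (\<lambda>p. - lin (restrict c I) I b p / of_int c0)"
        using eq that unfolding lin_eq by (auto simp: dep_def field_simps add_eq_0_iff fun_eq_iff)
      moreover have "(c0, restrict c I) \<in> C"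
        using that by (auto simp: C_def dep_def abs_le_iff minus_le_iff)
      ultimately show False using j unfolding bad_def by force
    qed
    have "similar L D (insert k0 I) (a(k0 := x)) (b(k0 := y j))"
    proof (rule res)
      have "(\<lambda>p. z p + of_int (- int j) * h p) \<in> loc_prod"
        using y0(2) subset[OF h(1)] by (rule loc_prod_add_scaled)
      moreover have "\<forall>p. x p = y j p + of_nat D * (z p + of_int (- int j) * h p)"
        using y0(3) by (simp add: y_def algebra_simps)
      ultimately show "\<exists>z\<in>loc_prod. \<forall>p. x p = y j p + of_nat D * z p"
        by (intro bexI[of _ "\<lambda>p. z p + of_int (- int j) * h p"])
    next
      fix e :: "'k \<Rightarrow> int" assume e: "\<forall>k. \<bar>e k\<bar> \<le> int L"
      show "(\<forall>p. of_int (e k0) * x p + lin e I a p = 0) \<longleftrightarrow> (\<forall>p. of_int (e k0) * y j p + lin e I b p = 0)"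
      proof (cases "e k0 = 0")
        case True
        have "lin e I a = (\<lambda>p. 0) \<longleftrightarrow> lin e I b = (\<lambda>p. 0)"
          using simL e unfolding similar_def by blast
        then show ?thesis using True by (simp add: fun_eq_iff)
      next
        case nz: False
        then have "dep e (e k0)" using e by (simp add: dep_def)
        then show ?thesis using False indep by blast
      qed
    qed
    then show ?thesis using yA by blast
  qed
qed

text \<open>A single group element brings one coordinate for each index in \<open>'n\<close>, so
  several entries must be added together. The bounds are chosen before \<open>A\<close>,
  \<open>I\<close> and the families, as quantifier steps in a formula require.\<close>

lemma similar_extend:
  fixes J :: "'k set"
  assumes "finite J" "D > 0"
  shows "\<exists>L' D'. D' > 0 \<and> (\<forall>A I a b x. pure_dense A \<and> finite I \<and> I \<inter> J = {} \<and> (\<forall>k\<in>I. b k \<in> A) \<and>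
    (\<forall>k\<in>J. x k \<in> loc_prod) \<and> similar L' D' I a b \<longrightarrow>
    (\<exists>y. (\<forall>k\<in>J. y k \<in> A) \<and> similar L D (I \<union> J) (\<lambda>k. if k \<in> J then x k else a k)
       (\<lambda>k. if k \<in> J then y k else b k)))"
  using assms
proof (induction J arbitrary: L D rule: finite_induct)
  case empty
  then show ?case by auto
next
  case (insert j J)
  then have "D * fact L > 0" by simp
  \<comment> \<open>The entry \<open>j\<close> is added last by \<open>similar_step\<close>, so the
    entries in \<open>J\<close> must already be matched to the precision that this lemma takes as
    input.\<close>
  from insert.IH[OF this, of "2 * L * L"] obtain L' D' where D': "D' > 0" and
    IH: "\<forall>A I a b x. pure_dense A \<and> finite I \<and> I \<inter> J = {} \<and> (\<forall>k\<in>I. b k \<in> A) \<and>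
    (\<forall>k\<in>J. x k \<in> loc_prod) \<and> similar L' D' I a b \<longrightarrow>
    (\<exists>y. (\<forall>k\<in>J. y k \<in> A) \<and> similar (2 * L * L) (D * fact L) (I \<union> J) (\<lambda>k. if k \<in> J then x k else a k)
       (\<lambda>k. if k \<in> J then y k else b k))"
    by (elim exE conjE)
  show ?case
  proof (intro exI[of _ L'] exI[of _ D'] conjI D' allI impI; elim conjE)
    fix A I and a b x :: "'k \<Rightarrow> nat \<Rightarrow> rat"
    assume A: "pure_dense A" and I: "finite I" "I \<inter> insert j J = {}" and b: "\<forall>k\<in>I. b k \<in> A"
      and x: "\<forall>k\<in>insert j J. x k \<in> loc_prod" and sim: "similar L' D' I a b"
    have "\<exists>y. (\<forall>k\<in>J. y k \<in> A) \<and> similar (2 * L * L) (D * fact L) (I \<union> J) (\<lambda>k. if k \<in> J then x k else a k)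
       (\<lambda>k. if k \<in> J then y k else b k)"
      using A I b x sim by (intro IH[rule_format]) auto
    then obtain y where y: "\<forall>k\<in>J. y k \<in> A" and
      simJ: "similar (2 * L * L) (D * fact L) (I \<union> J) (\<lambda>k. if k \<in> J then x k else a k)
       (\<lambda>k. if k \<in> J then y k else b k)" (is "similar _ _ _ ?a ?b") by blast
    have fin: "finite (I \<union> J)" and j: "j \<notin> I \<union> J" using I insert.hyps by auto
    have b': "?b k \<in> A" if "k \<in> I \<union> J" for k using that y b by auto
    have "x j \<in> loc_prod" using x by simp
    from pure_dense.similar_step[OF A fin j b' this insert.prems simJ] obtain v where
      v: "v \<in> A" "similar L D (insert j (I \<union> J)) (?a(j := x j)) (?b(j := v))" by blast
    have "?a(j := x j) = (\<lambda>k. if k \<in> insert j J then x k else a k)" by auto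
    moreover have "?b(j := v) = (\<lambda>k. if k \<in> insert j J then (y(j := v)) k else b k)"
      by (auto simp: fun_eq_iff)
    moreover have "\<forall>k\<in>insert j J. (y(j := v)) k \<in> A" using y v(1) by simp
    ultimately show "\<exists>y. (\<forall>k\<in>insert j J. y k \<in> A) \<and> similar L D (I \<union> insert j J)
        (\<lambda>k. if k \<in> insert j J then x k else a k) (\<lambda>k. if k \<in> insert j J then y k else b k)"
      using v(2) by (intro exI[of _ "y(j := v)"]) simp
  qed
qed

section \<open>Terms in semidirect products\<close>

lemma term_val_cong:
  assumes "\<And>v. v \<in> term_vars t \<Longrightarrow> e v = e' v"
  shows "term_val M e t = term_val M e' t"
  using assms by (induction t) auto

lemma is_struct_of_group: "group H \<Longrightarrow> is_struct (struct_of_group H)"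
  by (simp add: is_struct_def struct_of_group_def group.inv_closed group_def monoid.m_closed monoid.one_closed)

lemma struct_of_group_simps [simp]:
  "carrier (struct_of_group H) = carrier H"
  "monoid.mult (struct_of_group H) = monoid.mult H"
  "\<one>\<^bsub>struct_of_group H\<^esub> = \<one>\<^bsub>H\<^esub>"
  "inv_op (struct_of_group H) = m_inv H"
  by (simp_all add: struct_of_group_def)

lemma term_val_closed:
  assumes "is_struct M" "\<And>v. v \<in> term_vars t \<Longrightarrow> e v \<in> carrier M"
  shows "term_val M e t \<in> carrier M"
  using assms(2) by (induction t) (use assms(1) in \<open>auto simp: is_struct_def\<close>)

section \<open>The semidirect products of A^n with the finite group\<close>

locale finite_int_action = group G for G :: "'g monoid" (structure) +
  fixes \<alpha> :: "'g \<Rightarrow> int ^ 'n ^ 'n"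
  assumes finite_carrier: "finite (carrier G)"
    and action_hom: "\<alpha> \<in> hom G GL_int"
begin

lemma action_mult: "w \<in> carrier G \<Longrightarrow> v \<in> carrier G \<Longrightarrow> \<alpha> (w \<otimes> v) = \<alpha> w ** \<alpha> v"
  using hom_mult[OF action_hom] by (simp add: GL_int_def)

text \<open>Membership in \<open>hom\<close> records products only; the unit is recovered because an
  idempotent matrix with a left inverse is the identity.\<close>

lemma action_one: "\<alpha> \<one> = mat 1"
proof -
  have "\<alpha> \<one> = \<alpha> \<one> ** \<alpha> \<one>" using action_mult[of \<one> \<one>] by simp
  moreover obtain B where "B ** \<alpha> \<one> = mat 1"
    using hom_in_carrier[OF action_hom one_closed] by (auto simp: GL_int_def invertible_def)
  ultimately show ?thesis by (metis matrix_mul_assoc matrix_mul_lid)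
qed

definition act :: "'g \<Rightarrow> ('n \<Rightarrow> nat \<Rightarrow> rat) \<Rightarrow> 'n \<Rightarrow> nat \<Rightarrow> rat" where
  "act w x = (\<lambda>i. lin (\<lambda>j. \<alpha> w $ i $ j) UNIV x)"

lemma act_apply: "act w x i p = (\<Sum>j\<in>UNIV. of_int (\<alpha> w $ i $ j) * x j p)"
  by (simp add: act_def lin_def)

lemma act_one: "act \<one> x = x"
  by (intro ext) (simp add: act_apply action_one mat_def if_distrib[of "\<lambda>a. of_int a * _"] cong: if_cong)

lemma act_mult:
  assumes "w \<in> carrier G" "v \<in> carrier G"
  shows "act (w \<otimes> v) x = act w (act v x)"
proof (intro ext)
  fix i p
  have "act (w \<otimes> v) x i p = (\<Sum>l\<in>UNIV. \<Sum>j\<in>UNIV. of_int (\<alpha> w $ i $ j) * (of_int (\<alpha> v $ j $ l) * x l p))"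
    by (simp add: act_apply action_mult assms matrix_matrix_mult_def sum_distrib_right mult.assoc)
  also have "\<dots> = (\<Sum>j\<in>UNIV. \<Sum>l\<in>UNIV. of_int (\<alpha> w $ i $ j) * (of_int (\<alpha> v $ j $ l) * x l p))"
    by (rule sum.swap)
  finally show "act (w \<otimes> v) x i p = act w (act v x) i p"
    by (simp add: act_apply sum_distrib_left)
qed

lemma act_add: "act w (\<lambda>i p. x i p + y i p) i p = act w x i p + act w y i p"
  by (simp add: act_apply distrib_left sum.distrib)

definition sdp :: "(nat \<Rightarrow> rat) set \<Rightarrow> (('n \<Rightarrow> nat \<Rightarrow> rat) \<times> 'g) monoid" where
  "sdp A = \<lparr>carrier = {(x, w). (\<forall>i. x i \<in> A) \<and> w \<in> carrier G},
     monoid.mult = (\<lambda>(x, w) (y, v). (\<lambda>i p. x i p + act w y i p, w \<otimes> v)),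
     one = (\<lambda>i p. 0, \<one>)\<rparr>"

lemma sdp_simps:
  "(x, w) \<in> carrier (sdp A) \<longleftrightarrow> (\<forall>i. x i \<in> A) \<and> w \<in> carrier G"
  "(x, w) \<otimes>\<^bsub>sdp A\<^esub> (y, v) = (\<lambda>i p. x i p + act w y i p, w \<otimes> v)"
  "\<one>\<^bsub>sdp A\<^esub> = (\<lambda>i p. 0, \<one>)"
  by (simp_all add: sdp_def)

lemma act_mem:
  assumes "pure_dense A" "\<And>i. x i \<in> A"
  shows "act w x i \<in> A"
  unfolding act_def using assms by (intro pure_dense.lin_mem) auto

lemma sdp_inv_ex:
  assumes "pure_dense A" "(x, w) \<in> carrier (sdp A)"
  shows "(\<lambda>i p. - act (inv w) x i p, inv w) \<in> carrier (sdp A)"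
    and "(\<lambda>i p. - act (inv w) x i p, inv w) \<otimes>\<^bsub>sdp A\<^esub> (x, w) = \<one>\<^bsub>sdp A\<^esub>"
proof -
  have "(\<lambda>p. of_int (- 1) * act (inv w) x i p) \<in> A" for i
    using assms by (intro pure_dense.scale act_mem) (auto simp: sdp_simps)
  then show "(\<lambda>i p. - act (inv w) x i p, inv w) \<in> carrier (sdp A)"
    using assms(2) by (simp add: sdp_simps)
  show "(\<lambda>i p. - act (inv w) x i p, inv w) \<otimes>\<^bsub>sdp A\<^esub> (x, w) = \<one>\<^bsub>sdp A\<^esub>"
    using assms(2) by (simp add: sdp_simps)
qed

lemma group_sdp:
  assumes "pure_dense A"
  shows "group (sdp A)"
proof (rule groupI)
  interpret A: pure_dense A by fact
  show "\<one>\<^bsub>sdp A\<^esub> \<in> carrier (sdp A)" by (simp add: sdp_simps A.zero)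
  fix a b c assume a: "a \<in> carrier (sdp A)"
  obtain x w where xw: "a = (x, w)" by fastforce
  show "\<one>\<^bsub>sdp A\<^esub> \<otimes>\<^bsub>sdp A\<^esub> a = a" using a by (simp add: xw sdp_simps act_one)
  show "\<exists>y\<in>carrier (sdp A). y \<otimes>\<^bsub>sdp A\<^esub> a = \<one>\<^bsub>sdp A\<^esub>"
    using sdp_inv_ex[OF assms] a unfolding xw by blast
  assume b: "b \<in> carrier (sdp A)"
  obtain y v where yv: "b = (y, v)" by fastforce
  show "a \<otimes>\<^bsub>sdp A\<^esub> b \<in> carrier (sdp A)"
    using a b A.add act_mem[OF assms] by (simp add: xw yv sdp_simps)
  assume c: "c \<in> carrier (sdp A)"
  obtain z u where zu: "c = (z, u)" by fastforce
  show "a \<otimes>\<^bsub>sdp A\<^esub> b \<otimes>\<^bsub>sdp A\<^esub> c = a \<otimes>\<^bsub>sdp A\<^esub> (b \<otimes>\<^bsub>sdp A\<^esub> c)"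
    using a b c by (simp add: xw yv zu sdp_simps m_assoc act_mult act_add add.assoc)
qed

lemma inv_sdp:
  assumes "pure_dense A" "(x, w) \<in> carrier (sdp A)"
  shows "inv\<^bsub>sdp A\<^esub> (x, w) = (\<lambda>i p. - act (inv w) x i p, inv w)"
  using group.inv_equality[OF group_sdp] sdp_inv_ex assms by blast

section \<open>Evaluation of group words as bounded integer linear forms\<close>

definition coord :: "(nat \<Rightarrow> ('n \<Rightarrow> nat \<Rightarrow> rat) \<times> 'g) \<Rightarrow> nat \<times> 'n \<Rightarrow> nat \<Rightarrow> rat" where
  "coord e = (\<lambda>(v, i). fst (e v) i)"

abbreviation sdp_struct where "sdp_struct A \<equiv> struct_of_group (sdp A)"

text \<open>Projection to the finite factor is a homomorphism. Arguments are taken from the carrier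
  because the formula for inverses is available only there.\<close>

lemma snd_term_val:
  assumes "pure_dense A" "\<And>v. v \<in> term_vars t \<Longrightarrow> e v \<in> carrier (sdp A)"
  shows "snd (term_val (sdp_struct A) e t) = term_val (struct_of_group G) (snd \<circ> e) t"
  using assms(2)
proof (induction t)
  case (Inv t)
  have "term_val (sdp_struct A) e t \<in> carrier (sdp_struct A)"
    using Inv.prems by (intro term_val_closed is_struct_of_group group_sdp assms(1)) (auto simp: struct_of_group_def)
  then have "term_val (sdp_struct A) e t \<in> carrier (sdp A)" by (simp add: struct_of_group_def)
  then have "snd (inv\<^bsub>sdp A\<^esub> (term_val (sdp_struct A) e t)) = inv (snd (term_val (sdp_struct A) e t))"
    by (cases "term_val (sdp_struct A) e t") (simp add: inv_sdp assms(1))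
  then show ?case using Inv by (simp add: struct_of_group_def)
next
  case (Mul s t)
  then show ?case by (simp add: struct_of_group_def sdp_def split: prod.split) (metis snd_conv)
qed (simp_all add: struct_of_group_def sdp_simps)

text \<open>By finiteness of the acting group, one bound serves the matrices of all finite parts;
  this is what makes coefficient bounds independent of the assignment.\<close>

lemma action_bound: "\<exists>K. \<forall>w\<in>carrier G. \<forall>i j. \<bar>\<alpha> w $ i $ j\<bar> \<le> int K"
proof -
  define S where "S = (\<lambda>(w, i, j). nat \<bar>\<alpha> w $ i $ j\<bar>) ` (carrier G \<times> UNIV \<times> UNIV)"
  have "finite S" unfolding S_def using finite_carrier by simp
  then obtain K where "\<forall>s\<in>S. s \<le> K" using finite_nat_set_iff_bounded_le by blast
  then have "\<forall>w\<in>carrier G. \<forall>i j. \<bar>\<alpha> w $ i $ j\<bar> \<le> int K"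
    unfolding S_def by (auto simp: nat_le_iff)
  then show ?thesis by blast
qed

lemma act_lin:
  "act w (\<lambda>i. lin (c i) V f) i p = lin (\<lambda>k. \<Sum>j\<in>UNIV. \<alpha> w $ i $ j * c j k) V f p"
proof -
  have "act w (\<lambda>i. lin (c i) V f) i p
      = (\<Sum>j\<in>UNIV. \<Sum>k\<in>V. of_int (\<alpha> w $ i $ j) * (of_int (c j k) * f k p))"
    by (simp add: act_apply lin_def sum_distrib_left)
  also have "\<dots> = (\<Sum>k\<in>V. \<Sum>j\<in>UNIV. of_int (\<alpha> w $ i $ j) * (of_int (c j k) * f k p))"
    by (rule sum.swap)
  finally show ?thesis by (simp add: lin_def sum_distrib_right mult.assoc)
qed

lemma act_coeff_bound:
  assumes "\<forall>w\<in>carrier G. \<forall>i j. \<bar>\<alpha> w $ i $ j\<bar> \<le> int K" "w \<in> carrier G" "\<And>j k. \<bar>c j k\<bar> \<le> int L"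
  shows "\<bar>\<Sum>j\<in>UNIV. \<alpha> w $ i $ j * c j k\<bar> \<le> int (CARD('n) * (K * L))"
proof -
  have "\<bar>\<alpha> w $ i $ j * c j k\<bar> \<le> int K * int L" for j
    unfolding abs_mult using assms by (intro mult_mono) auto
  then have "\<bar>\<Sum>j\<in>UNIV. \<alpha> w $ i $ j * c j k\<bar> \<le> (\<Sum>j\<in>(UNIV :: 'n set). int K * int L)"
    by (intro order.trans[OF sum_abs] sum_mono)
  then show ?thesis by simp
qed

text \<open>The coefficients are fixed by the term and the finite parts \<open>w\<close>, and then
  serve every \<open>A\<close> and every \<open>e\<close>. Two assignments with equal finite parts,
  even over different groups, thus give the same linear forms.\<close>

definition coeffs_for ::
    "nat set \<Rightarrow> (nat \<Rightarrow> 'g) \<Rightarrow> gterm \<Rightarrow> ('n \<Rightarrow> nat \<times> 'n \<Rightarrow> int) \<Rightarrow> bool" where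
  "coeffs_for V w t c \<longleftrightarrow>
     (\<forall>A e. pure_dense A \<and> (\<forall>v\<in>V. e v \<in> carrier (sdp A) \<and> snd (e v) = w v) \<longrightarrow>
        fst (term_val (sdp_struct A) e t) = (\<lambda>i. lin (c i) (V \<times> UNIV) (coord e)))"

text \<open>The bound precedes \<open>V\<close> and \<open>w\<close>: it has to be known before the
  finite parts of quantified variables are.\<close>

definition coeff_bound :: "gterm \<Rightarrow> nat \<Rightarrow> bool" where
  "coeff_bound t L \<longleftrightarrow> (\<forall>V w. finite V \<and> term_vars t \<subseteq> V \<and> w ` V \<subseteq> carrier G \<longrightarrow>
     (\<exists>c. (\<forall>i k. \<bar>c i k\<bar> \<le> int L) \<and> coeffs_for V w t c))"

lemma coeff_boundE:
  assumes "coeff_bound t L" "finite V" "term_vars t \<subseteq> V" "w ` V \<subseteq> carrier G"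
  obtains c where "\<And>i k. \<bar>c i k\<bar> \<le> int L" "coeffs_for V w t c"
proof -
  have "\<exists>c. (\<forall>i k. \<bar>c i k\<bar> \<le> int L) \<and> coeffs_for V w t c"
    using assms(2-4) by (intro assms(1)[unfolded coeff_bound_def, rule_format] conjI)
  then obtain c where c: "\<forall>i k. \<bar>c i k\<bar> \<le> int L" "coeffs_for V w t c" by (elim exE conjE)
  show thesis by (rule that[OF c(1)[rule_format] c(2)])
qed

text \<open>The coefficients depend on the finite parts of the arguments, but their bound does not.\<close>

lemma ex_coeff_bound: "\<exists>L. coeff_bound t L"
proof (induction t)
  case (Var x)
  show ?case
    unfolding coeff_bound_def
  proof (intro exI[of _ 1] allI impI)
    fix V and w :: "nat \<Rightarrow> 'g"
    assume V: "finite V \<and> term_vars (Var x) \<subseteq> V \<and> w ` V \<subseteq> carrier G"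
    define c :: "'n \<Rightarrow> nat \<times> 'n \<Rightarrow> int" where "c = (\<lambda>i k. if k = (x, i) then 1 else 0)"
    have "fst (e x) = (\<lambda>i. lin (c i) (V \<times> UNIV) (coord e))" for e
      using V by (intro ext) (simp add: lin_def c_def coord_def if_distrib[of "\<lambda>a. of_int a * _"] cong: if_cong)
    then show "\<exists>c. (\<forall>i k. \<bar>c i k\<bar> \<le> int 1) \<and>
       coeffs_for V w (Var x) c"
      by (intro exI[of _ c]) (simp add: c_def coeffs_for_def)
  qed
next
  case One
  have "fst (term_val (sdp_struct A) e One) = (\<lambda>i. lin (\<lambda>_. 0) (V \<times> UNIV) (coord e))" for A e V
    by (simp add: struct_of_group_def sdp_simps lin_def)
  then have "coeffs_for V w One (\<lambda>_ _. 0)" for V w unfolding coeffs_for_def by blast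
  then have "coeff_bound One 0"
    unfolding coeff_bound_def by (metis abs_zero of_nat_0 order_refl)
  then show ?case by blast
next
  case (Inv t)
  obtain K where K: "\<forall>w\<in>carrier G. \<forall>i j. \<bar>\<alpha> w $ i $ j\<bar> \<le> int K" using action_bound by blast
  obtain L where L: "coeff_bound t L" using Inv.IH by blast
  show ?case
    unfolding coeff_bound_def
  \<comment> \<open>Inversion applies the matrix of \<open>inv u\<close> to the negated vector, so a
    new coefficient is a sum of \<open>CARD('n)\<close> products, each of size at most K *
    L.\<close>
  proof (intro exI[of _ "CARD('n) * (K * L)"] allI impI)
    fix V and w :: "nat \<Rightarrow> 'g"
    assume V: "finite V \<and> term_vars (Inv t) \<subseteq> V \<and> w ` V \<subseteq> carrier G"
    then obtain c where c: "\<And>i k. \<bar>c i k\<bar> \<le> int L" and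
      eq: "coeffs_for V w t c"
      using coeff_boundE[OF L, of V w] by auto
    \<comment> \<open>The finite part of the value of \<open>t\<close>; it depends on
      \<open>w\<close> alone, so the matrix below is the same for all \<open>A\<close> and
      \<open>e\<close>.\<close>
    define u where "u = term_val (struct_of_group G) w t"
    have "u \<in> carrier (struct_of_group G)"
      unfolding u_def using V by (intro term_val_closed is_struct_of_group group_axioms)
        (auto simp: struct_of_group_def)
    then have u: "u \<in> carrier G" by (simp add: struct_of_group_def)
    define d where "d = (\<lambda>i k. \<Sum>j\<in>UNIV. \<alpha> (inv u) $ i $ j * (- c j k))"
    have "\<bar>d i k\<bar> \<le> int (CARD('n) * (K * L))" for i k
      unfolding d_def using K c u by (intro act_coeff_bound) auto
    moreover have "fst (term_val (sdp_struct A) e (Inv t)) = (\<lambda>i. lin (d i) (V \<times> UNIV) (coord e))"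
      if A: "pure_dense A \<and> (\<forall>v\<in>V. e v \<in> carrier (sdp A) \<and> snd (e v) = w v)" for A e
    proof -
      have "term_val (sdp_struct A) e t \<in> carrier (sdp_struct A)"
        using A V by (intro term_val_closed is_struct_of_group group_sdp)
          (auto simp: struct_of_group_def)
      then have mem: "term_val (sdp_struct A) e t \<in> carrier (sdp A)" by (simp add: struct_of_group_def)
      have "term_val (struct_of_group G) (snd \<circ> e) t = u"
        unfolding u_def using A V
        by (intro term_val_cong) auto
      then have "snd (term_val (sdp_struct A) e t) = u"
        using snd_term_val[of A t e] A V by auto
      then obtain x where x: "term_val (sdp_struct A) e t = (x, u)" by (metis prod.collapse)
      then have "inv\<^bsub>sdp A\<^esub> (term_val (sdp_struct A) e t) = (\<lambda>i p. - act (inv u) x i p, inv u)"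
        using inv_sdp[of A x u] mem A by simp
      then have "fst (term_val (sdp_struct A) e (Inv t))
          = (\<lambda>i p. - act (inv u) (fst (term_val (sdp_struct A) e t)) i p)"
        by (simp add: x)
      also have "\<dots> = (\<lambda>i. lin (d i) (V \<times> UNIV) (coord e))"
        unfolding eq[unfolded coeffs_for_def, rule_format, OF A] act_lin by (simp add: d_def lin_def sum_negf)
      finally show ?thesis .
    qed
    ultimately show "\<exists>c. (\<forall>i k. \<bar>c i k\<bar> \<le> int (CARD('n) * (K * L))) \<and>
       coeffs_for V w (Inv t) c"
      unfolding coeffs_for_def by blast
  qed
next
  case (Mul s t)
  obtain K where K: "\<forall>w\<in>carrier G. \<forall>i j. \<bar>\<alpha> w $ i $ j\<bar> \<le> int K" using action_bound by blast
  obtain L where L: "coeff_bound t L" using Mul.IH(2) by blast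
  obtain L' where L': "coeff_bound s L'" using Mul.IH(1) by blast
  show ?case
    unfolding coeff_bound_def
  \<comment> \<open>In a product the vector of \<open>s\<close> is kept, while that of
    \<open>t\<close> is moved by the matrix of the finite part of \<open>s\<close>.\<close>
  proof (intro exI[of _ "L' + CARD('n) * (K * L)"] allI impI)
    fix V and w :: "nat \<Rightarrow> 'g"
    assume V: "finite V \<and> term_vars (Mul s t) \<subseteq> V \<and> w ` V \<subseteq> carrier G"
    then obtain c where c: "\<And>i k. \<bar>c i k\<bar> \<le> int L" and
      eq: "coeffs_for V w t c"
      using coeff_boundE[OF L, of V w] by auto
    obtain c' where c': "\<And>i k. \<bar>c' i k\<bar> \<le> int L'" and
      eq': "coeffs_for V w s c'"
      using coeff_boundE[OF L', of V w] V by auto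
    define u where "u = term_val (struct_of_group G) w s"
    have "u \<in> carrier (struct_of_group G)"
      unfolding u_def using V by (intro term_val_closed is_struct_of_group group_axioms)
        (auto simp: struct_of_group_def)
    then have u: "u \<in> carrier G" by (simp add: struct_of_group_def)
    define d where "d = (\<lambda>i k. \<Sum>j\<in>UNIV. \<alpha> u $ i $ j * c j k)"
    have d: "\<bar>d i k\<bar> \<le> int (CARD('n) * (K * L))" for i k
      unfolding d_def using K c u by (intro act_coeff_bound) auto
    have "\<bar>c' i k + d i k\<bar> \<le> int (L' + CARD('n) * (K * L))" for i k
      using abs_triangle_ineq[of "c' i k" "d i k"] c'[of i k] d[of i k] by linarith
    moreover have "fst (term_val (sdp_struct A) e (Mul s t))
        = (\<lambda>i. lin (\<lambda>k. c' i k + d i k) (V \<times> UNIV) (coord e))"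
      if A: "pure_dense A \<and> (\<forall>v\<in>V. e v \<in> carrier (sdp A) \<and> snd (e v) = w v)" for A e
    proof -
      have "term_val (struct_of_group G) (snd \<circ> e) s = u"
        unfolding u_def using A V
        by (intro term_val_cong) auto
      then have "snd (term_val (sdp_struct A) e s) = u"
        using snd_term_val[of A s e] A V by auto
      then have "fst (term_val (sdp_struct A) e (Mul s t))
          = (\<lambda>i p. fst (term_val (sdp_struct A) e s) i p + act u (fst (term_val (sdp_struct A) e t)) i p)"
        by (cases "term_val (sdp_struct A) e s"; cases "term_val (sdp_struct A) e t")
          (simp add: sdp_simps)
      also have "\<dots> = (\<lambda>i. lin (\<lambda>k. c' i k + d i k) (V \<times> UNIV) (coord e))"
        unfolding eq[unfolded coeffs_for_def, rule_format, OF A] eq'[unfolded coeffs_for_def, rule_format, OF A] act_lin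
        by (simp add: d_def lin_def sum.distrib distrib_right)
      finally show ?thesis .
    qed
    ultimately show "\<exists>c. (\<forall>i k. \<bar>c i k\<bar> \<le> int (L' + CARD('n) * (K * L))) \<and>
       coeffs_for V w (Mul s t) c"
      by (intro exI[of _ "\<lambda>i k. c' i k + d i k"]) (unfold coeffs_for_def, blast)
  qed
qed

end

section \<open>Elementary equivalence and prime models\<close>

definition struct_iso :: "('a \<Rightarrow> 'b) \<Rightarrow> 'a gstruct \<Rightarrow> 'b gstruct \<Rightarrow> bool" where
  "struct_iso h M N \<longleftrightarrow> bij_betw h (carrier M) (carrier N) \<and> h \<one>\<^bsub>M\<^esub> = \<one>\<^bsub>N\<^esub> \<and>
     (\<forall>a\<in>carrier M. h (inv_op M a) = inv_op N (h a)) \<and>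
     (\<forall>a\<in>carrier M. \<forall>b\<in>carrier M. h (a \<otimes>\<^bsub>M\<^esub> b) = h a \<otimes>\<^bsub>N\<^esub> h b)"

lemma term_val_struct_iso:
  assumes "is_struct M" "struct_iso h M N" "range e \<subseteq> carrier M"
  shows "term_val N (h \<circ> e) t = h (term_val M e t)"
proof (induction t)
  case (Inv t)
  have "term_val M e t \<in> carrier M" using assms by (intro term_val_closed) auto
  then show ?case using Inv assms(2) by (simp add: struct_iso_def)
next
  case (Mul s t)
  have "term_val M e s \<in> carrier M" "term_val M e t \<in> carrier M"
    using assms by (auto intro!: term_val_closed)
  then show ?case using Mul assms(2) by (simp add: struct_iso_def)
qed (use assms(2) in \<open>simp_all add: struct_iso_def\<close>)

lemma sat_struct_iso:
  assumes "is_struct M" "struct_iso h M N" "range e \<subseteq> carrier M"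
  shows "sat N (h \<circ> e) p \<longleftrightarrow> sat M e p"
  using assms(3)
proof (induction p arbitrary: e)
  case (Eq s t)
  have "inj_on h (carrier M)" using assms(2) by (simp add: struct_iso_def bij_betw_def)
  moreover have "term_val M e s \<in> carrier M" "term_val M e t \<in> carrier M"
    using assms(1) Eq.prems by (auto intro!: term_val_closed)
  ultimately show ?case
    unfolding sat.simps term_val_struct_iso[OF assms(1,2) Eq.prems] by (simp add: inj_on_eq_iff)
next
  case (Ex x p)
  have im: "carrier N = h ` carrier M" using assms(2) by (simp add: struct_iso_def bij_betw_def)
  have "sat N ((h \<circ> e)(x := h a)) p \<longleftrightarrow> sat M (e(x := a)) p" if "a \<in> carrier M" for a
  proof -
    have "h \<circ> e(x := a) = (h \<circ> e)(x := h a)" by auto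
    moreover have "range (e(x := a)) \<subseteq> carrier M" using Ex.prems that by auto
    ultimately show ?thesis using Ex.IH[of "e(x := a)"] by metis
  qed
  then show ?case unfolding sat.simps im by blast
qed simp_all

lemma holds_struct_iso:
  assumes "is_struct M" "struct_iso h M N"
  shows "holds N p \<longleftrightarrow> holds M p"
proof
  have im: "carrier N = h ` carrier M" using assms(2) by (simp add: struct_iso_def bij_betw_def)
  show "holds M p" if "holds N p"
    unfolding holds_def
  proof (intro allI impI)
    fix e :: "nat \<Rightarrow> _" assume e: "range e \<subseteq> carrier M"
    then have "range (h \<circ> e) \<subseteq> carrier N" using im by auto
    then show "sat M e p" using that sat_struct_iso[OF assms e] unfolding holds_def by blast
  qed
  show "holds N p" if "holds M p"
    unfolding holds_def
  proof (intro allI impI)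
    fix e :: "nat \<Rightarrow> _" assume e: "range e \<subseteq> carrier N"
    define e' where "e' = inv_into (carrier M) h \<circ> e"
    have "range e' \<subseteq> carrier M" using e im by (auto simp: e'_def intro!: inv_into_into)
    moreover have "h \<circ> e' = e"
      using e im by (auto simp: e'_def fun_eq_iff image_subset_iff intro!: f_inv_into_f)
    ultimately show "sat N e p"
      using that sat_struct_iso[OF assms, of e'] unfolding holds_def by metis
  qed
qed

lemma struct_iso_inv:
  assumes "is_struct M" "struct_iso h M N"
  shows "struct_iso (inv_into (carrier M) h) N M"
proof -
  have bij: "bij_betw h (carrier M) (carrier N)" using assms(2) by (simp add: struct_iso_def)
  then have im: "carrier N = h ` carrier M" and inj: "inj_on h (carrier M)"
    by (simp_all add: bij_betw_def)
  have eq: "inv_into (carrier M) h y = x" if "x \<in> carrier M" "y = h x" for x y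
    using that inj by simp
  show ?thesis
    using assms bij_betw_inv_into[OF bij] unfolding struct_iso_def is_struct_def im
    by (auto simp: inj intro!: eq)
qed

lemma ex_struct_iso_image:
  assumes "inj_on g (carrier M)" "is_struct M"
  shows "\<exists>N. struct_iso g M N \<and> is_struct N"
proof -
  define i where "i = inv_into (carrier M) g"
  have i: "i (g a) = a" if "a \<in> carrier M" for a
    using that assms(1) by (simp add: i_def)
  let ?N = "\<lparr>carrier = g ` carrier M, monoid.mult = (\<lambda>a b. g (i a \<otimes>\<^bsub>M\<^esub> i b)),
    one = g \<one>\<^bsub>M\<^esub>, inv_op = (\<lambda>a. g (inv_op M (i a)))\<rparr>"
  have "struct_iso g M ?N" using assms(1) i by (simp add: struct_iso_def bij_betw_def)
  moreover have "is_struct ?N" using assms(2) i by (auto simp: is_struct_def)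
  ultimately show ?thesis by blast
qed

text \<open>Primality gives embeddings only into structures over \<open>'u\<close>. A countable
  model is copied into \<open>'u\<close> along an injection of the naturals, and the embedding into
  the copy is composed with the isomorphism back.\<close>

lemma prime_model_embeds:
  fixes M :: "'m gstruct" and S :: "'s gstruct"
  assumes prime: "prime_model TYPE('u) T M" and S: "is_model S T" "countable (carrier S)"
    and inf: "infinite (UNIV :: 'u set)"
  shows "\<exists>f. elementary_embedding f M S"
proof -
  obtain r :: "nat \<Rightarrow> 'u" where r: "inj r" using inf infinite_countable_subset by blast
  define g where "g = r \<circ> to_nat_on (carrier S)"
  have "inj_on g (carrier S)"
    unfolding g_def using S(2) r by (intro comp_inj_on) (auto intro: inj_on_subset)
  then obtain N :: "'u gstruct" where N: "struct_iso g S N" "is_struct N"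
    using ex_struct_iso_image S(1) unfolding is_model_def by blast
  have sS: "is_struct S" using S(1) by (simp add: is_model_def)
  then have "is_model N T" using S(1) N holds_struct_iso[OF sS N(1)] by (simp add: is_model_def)
  then obtain f where f: "elementary_embedding f M N" using prime unfolding prime_model_def by blast
  define h where "h = inv_into (carrier S) g"
  have h: "struct_iso h N S" unfolding h_def using struct_iso_inv[OF sS N(1)] .
  have "elementary_embedding (h \<circ> f) M S"
    unfolding elementary_embedding_def
  proof (intro conjI allI impI)
    have im: "f ` carrier M \<subseteq> carrier N" using f by (simp add: elementary_embedding_def)
    then show "(h \<circ> f) ` carrier M \<subseteq> carrier S"
      using h by (auto simp: struct_iso_def bij_betw_def image_subset_iff)
    fix p and e :: "nat \<Rightarrow> 'm" assume e: "range e \<subseteq> carrier M"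
    then have "range (f \<circ> e) \<subseteq> carrier N" using im by auto
    then have "sat S (h \<circ> (f \<circ> e)) p \<longleftrightarrow> sat N (f \<circ> e) p" by (rule sat_struct_iso[OF N(2) h])
    moreover have "sat M e p \<longleftrightarrow> sat N (f \<circ> e) p" using f e by (simp add: elementary_embedding_def)
    ultimately show "sat M e p \<longleftrightarrow> sat S (h \<circ> f \<circ> e) p" by (simp add: comp_assoc)
  qed
  then show ?thesis by blast
qed

primrec pow_term :: "gterm \<Rightarrow> nat \<Rightarrow> gterm" where
  "pow_term t 0 = One"
| "pow_term t (Suc m) = Mul (pow_term t m) t"

lemma term_val_pow_term:
  "term_val (struct_of_group H) e (pow_term t m) = term_val (struct_of_group H) e t [^]\<^bsub>H\<^esub> m"
  by (induction m) (simp_all add: nat_pow_def)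

lemma term_vars_pow_term: "term_vars (pow_term t m) \<subseteq> term_vars t"
  by (induction m) auto

lemma finite_term_vars: "finite (term_vars t)"
  by (induction t) auto

lemma finite_free_vars: "finite (free_vars p)"
  by (induction p) (auto simp: finite_term_vars)

lemma (in group) pow_pow_swap:
  assumes "x \<in> carrier G"
  shows "(x [^] (k :: nat)) [^] (m :: nat) = (x [^] m) [^] k"
  using assms by (simp add: nat_pow_pow mult.commute)

section \<open>Transfer of formulas between the semidirect products\<close>

context finite_int_action
begin

text \<open>Finite parts are matched exactly, which fixes the linear forms of all terms; only the
  vectors are matched approximately.\<close>

definition sim_on where
  "sim_on L D V A B e e' \<longleftrightarrow>
     (\<forall>v\<in>V. e v \<in> carrier (sdp A) \<and> e' v \<in> carrier (sdp B) \<and> snd (e v) = snd (e' v)) \<and>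
     similar L D (V \<times> UNIV) (coord e) (coord e')"

lemma sim_on_mono:
  assumes "sim_on L' D' V' A B e e'" "L \<le> L'" "D dvd D'" "V \<subseteq> V'" "finite V'"
  shows "sim_on L D V A B e e'"
proof -
  have "V \<times> (UNIV :: 'n set) \<subseteq> V' \<times> UNIV" "finite (V' \<times> (UNIV :: 'n set))" using assms by auto
  then have "similar L D (V \<times> UNIV) (coord e) (coord e')"
    using similar_mono assms(1-3) unfolding sim_on_def by blast
  then show ?thesis using assms(1,4) unfolding sim_on_def by blast
qed

lemma sim_on_sym: "sim_on L D V A B e e' \<Longrightarrow> sim_on L D V B A e' e"
  unfolding sim_on_def by (auto intro: similar_sym)

text \<open>\<open>L\<close> and \<open>D\<close> measure what the formula can detect, in the manner
  of an Ehrenfeucht-Fraisse game of finite length.\<close>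

definition transfers :: "nat \<Rightarrow> nat \<Rightarrow> gformula \<Rightarrow> bool" where
  "transfers L D p \<longleftrightarrow>
     (\<forall>A B e e'. pure_dense A \<and> pure_dense B \<and> sim_on L D (free_vars p) A B e e' \<longrightarrow>
       (sat (sdp_struct A) e p \<longleftrightarrow> sat (sdp_struct B) e' p))"

lemma transfersI:
  assumes "\<And>A B e e'. pure_dense A \<Longrightarrow> pure_dense B \<Longrightarrow> sim_on L D (free_vars p) A B e e' \<Longrightarrow>
    sat (sdp_struct A) e p \<longleftrightarrow> sat (sdp_struct B) e' p"
  shows "transfers L D p"
  using assms unfolding transfers_def by blast

lemma transfersD:
  assumes "transfers L D p" "pure_dense A" "pure_dense B" "sim_on L D (free_vars p) A B e e'"
  shows "sat (sdp_struct A) e p \<longleftrightarrow> sat (sdp_struct B) e' p"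
  using assms unfolding transfers_def by blast

text \<open>An equation splits into an equation between finite parts, the same on both sides, and
  one linear relation per coordinate whose coefficients are differences, hence at most L1 + L2.
  Congruences matter only once quantifiers appear, hence the modulus 1.\<close>

lemma transfers_Eq: "\<exists>L. transfers L 1 (Eq s t)"
proof -
  define V where "V = free_vars (Eq s t)"
  obtain L1 where L1: "coeff_bound s L1" using ex_coeff_bound by blast
  obtain L2 where L2: "coeff_bound t L2" using ex_coeff_bound by blast
  have "transfers (L1 + L2) 1 (Eq s t)"
  proof (rule transfersI, fold V_def)
    fix A B e e'
    assume A: "pure_dense A" and B: "pure_dense B" and sim: "sim_on (L1 + L2) 1 V A B e e'"
    define w where "w = snd \<circ> e"
    have V: "finite V" "term_vars s \<subseteq> V" "term_vars t \<subseteq> V"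
      unfolding V_def by (auto simp: finite_term_vars)
    have ev: "e v \<in> carrier (sdp A) \<and> snd (e v) = w v" "e' v \<in> carrier (sdp B) \<and> snd (e' v) = w v"
      if "v \<in> V" for v
      using sim that unfolding sim_on_def w_def by auto
    have w: "w ` V \<subseteq> carrier G"
    proof
      fix u assume "u \<in> w ` V"
      then obtain v where "v \<in> V" "u = w v" by blast
      then show "u \<in> carrier G" using ev(1)[of v] by (cases "e v") (simp add: sdp_simps)
    qed
    obtain c1 where c1: "\<And>i k. \<bar>c1 i k\<bar> \<le> int L1" "coeffs_for V w s c1"
      using coeff_boundE[OF L1 V(1,2) w] by blast
    obtain c2 where c2: "\<And>i k. \<bar>c2 i k\<bar> \<le> int L2" "coeffs_for V w t c2"
      using coeff_boundE[OF L2 V(1,3) w] by blast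
    have char: "sat (sdp_struct C) f (Eq s t) \<longleftrightarrow>
        (\<forall>i. lin (\<lambda>k. c1 i k - c2 i k) (V \<times> UNIV) (coord f) = (\<lambda>p. 0)) \<and>
        term_val (struct_of_group G) w s = term_val (struct_of_group G) w t"
      if C: "pure_dense C" and f: "\<And>v. v \<in> V \<Longrightarrow> f v \<in> carrier (sdp C) \<and> snd (f v) = w v" for C f
    proof -
      have fst: "fst (term_val (sdp_struct C) f s) = (\<lambda>i. lin (c1 i) (V \<times> UNIV) (coord f))"
        "fst (term_val (sdp_struct C) f t) = (\<lambda>i. lin (c2 i) (V \<times> UNIV) (coord f))"
        using c1(2) c2(2) C f unfolding coeffs_for_def by blast+
      have snd: "snd (term_val (sdp_struct C) f r) = term_val (struct_of_group G) w r"
        if "term_vars r \<subseteq> V" for r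
      proof -
        have "snd (term_val (sdp_struct C) f r) = term_val (struct_of_group G) (snd \<circ> f) r"
          using that f by (intro snd_term_val C) auto
        also have "\<dots> = term_val (struct_of_group G) w r"
          using that f by (intro term_val_cong) auto
        finally show ?thesis .
      qed
      have "lin (\<lambda>k. c1 i k - c2 i k) (V \<times> UNIV) (coord f) p
          = lin (c1 i) (V \<times> UNIV) (coord f) p - lin (c2 i) (V \<times> UNIV) (coord f) p" for i p
        by (simp add: lin_def sum_subtractf left_diff_distrib)
      then show ?thesis
        unfolding sat.simps prod_eq_iff fst snd[OF V(2)] snd[OF V(3)] by (auto simp: fun_eq_iff)
    qed
    have "lin (\<lambda>k. c1 i k - c2 i k) (V \<times> UNIV) (coord e) = (\<lambda>p. 0)
        \<longleftrightarrow> lin (\<lambda>k. c1 i k - c2 i k) (V \<times> UNIV) (coord e') = (\<lambda>p. 0)" for i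
    proof -
      have "similar (L1 + L2) 1 (V \<times> UNIV) (coord e) (coord e')"
        using sim by (simp add: sim_on_def)
      moreover have "\<bar>c1 i k - c2 i k\<bar> \<le> int (L1 + L2)" for k
        using abs_triangle_ineq4[of "c1 i k" "c2 i k"] c1(1)[of i k] c2(1)[of i k] by linarith
      ultimately show ?thesis by (rule similar_relation_iff)
    qed
    then show "sat (sdp_struct A) e (Eq s t) \<longleftrightarrow> sat (sdp_struct B) e' (Eq s t)"
      using char[OF A ev(1)] char[OF B ev(2)] by simp
  qed
  then show ?thesis by blast
qed

text \<open>The coordinates of the new value are matched through \<open>similar_extend\<close>. The
  variable \<open>v\<close> is removed from the hypothesis because its old value is
  overwritten.\<close>

lemma sim_on_extend:
  assumes "D > 0" "finite V"
  shows "\<exists>L' D'. D' > 0 \<and> (\<forall>A B e e' x. pure_dense A \<and> pure_dense B \<and>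
     sim_on L' D' (V - {v}) A B e e' \<and> x \<in> carrier (sdp A) \<longrightarrow>
     (\<exists>y\<in>carrier (sdp B). sim_on L D V A B (e(v := x)) (e'(v := y))))"
proof -
  define J :: "(nat \<times> 'n) set" where "J = {v} \<times> UNIV"
  define I :: "(nat \<times> 'n) set" where "I = (V - {v}) \<times> UNIV"
  have "finite J" by (simp add: J_def)
  define ext where "ext L' D' \<longleftrightarrow> (\<forall>A I a b x. pure_dense A \<and> finite I \<and> I \<inter> J = {} \<and> (\<forall>k\<in>I. b k \<in> A) \<and>
      (\<forall>k\<in>J. x k \<in> loc_prod) \<and> similar L' D' I a b \<longrightarrow>
      (\<exists>y. (\<forall>k\<in>J. y k \<in> A) \<and> similar L D (I \<union> J) (\<lambda>k. if k \<in> J then x k else a k)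
       (\<lambda>k. if k \<in> J then y k else b k)))" for L' D'
  have "\<exists>L' D'. D' > 0 \<and> ext L' D'"
    unfolding ext_def by (rule similar_extend[OF \<open>finite J\<close> assms(1)])
  then obtain L' D' where D': "D' > 0" and ext: "ext L' D'" by blast
  have "\<exists>y\<in>carrier (sdp B). sim_on L D V A B (e(v := x)) (e'(v := y))"
    if A: "pure_dense A" and B: "pure_dense B" and sim: "sim_on L' D' (V - {v}) A B e e'"
      and x: "x \<in> carrier (sdp A)" for A B e e' x
  proof -
    obtain xv w where xw: "x = (xv, w)" by fastforce
    have b: "coord e' k \<in> B" if k: "k \<in> I" for k
    proof -
      obtain u i where k: "k = (u, i)" "u \<in> V - {v}" using k by (cases k) (auto simp: I_def)
      then have "e' u \<in> carrier (sdp B)" using sim unfolding sim_on_def by blast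
      then show ?thesis by (cases "e' u") (simp add: k coord_def sdp_simps)
    qed
    have xl: "xv (snd k) \<in> loc_prod" for k :: "nat \<times> 'n"
      using x pure_dense.subset[OF A] by (simp add: xw sdp_simps)
    have "\<exists>y. (\<forall>k\<in>J. y k \<in> B) \<and> similar L D (I \<union> J) (\<lambda>k. if k \<in> J then xv (snd k) else coord e k)
       (\<lambda>k. if k \<in> J then y k else coord e' k)"
      using B assms(2) b xl sim by (intro ext[unfolded ext_def, rule_format]) (auto simp: I_def J_def sim_on_def)
    then obtain y where y: "\<forall>k\<in>J. y k \<in> B" and simIJ:
      "similar L D (I \<union> J) (\<lambda>k. if k \<in> J then xv (snd k) else coord e k)
       (\<lambda>k. if k \<in> J then y k else coord e' k)" by blast
    \<comment> \<open>The witness copies the finite part \<open>w\<close> of \<open>x\<close>; only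
      its vector is new.\<close>
    define y' where "y' = (\<lambda>i. y (v, i), w)"
    have y': "y' \<in> carrier (sdp B)" using y x by (simp add: y'_def J_def xw sdp_simps)
    have "(\<lambda>k. if k \<in> J then xv (snd k) else coord e k) = coord (e(v := x))"
      "(\<lambda>k. if k \<in> J then y k else coord e' k) = coord (e'(v := y'))"
      by (auto simp: fun_eq_iff J_def coord_def xw y'_def)
    then have simIJ': "similar L D (I \<union> J) (coord (e(v := x))) (coord (e'(v := y')))" using simIJ by simp
    have "finite (I \<union> J)" "V \<times> UNIV \<subseteq> I \<union> J" using assms(2) by (auto simp: I_def J_def)
    then have "similar L D (V \<times> UNIV) (coord (e(v := x))) (coord (e'(v := y')))"
      using similar_mono[OF simIJ' order_refl dvd_refl] by blast
    then have "sim_on L D V A B (e(v := x)) (e'(v := y'))"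
      using sim x y' unfolding sim_on_def by (auto simp: xw y'_def)
    then show ?thesis using y' by blast
  qed
  then show ?thesis using D' by blast
qed

text \<open>Witnesses of an existential quantifier are carried over by \<open>sim_on_extend\<close>;
  since \<open>sim_on\<close> is symmetric, one direction yields both.\<close>

lemma ex_transfers: "\<exists>L D. D > 0 \<and> transfers L D p"
proof (induction p)
  case (Eq s t)
  then show ?case using transfers_Eq zero_less_one by blast
next
  case (Neg p)
  then show ?case by (simp add: transfers_def)
next
  case (Conj p q)
  obtain L D L' D' where D: "D > 0" "D' > 0" and p: "transfers L D p" and q: "transfers L' D' q"
    using Conj.IH by blast
  \<comment> \<open>The larger coefficient bound and a common multiple of the moduli imply the
    requirements of both conjuncts.\<close>
  have "transfers (max L L') (D * D') (Conj p q)"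
  proof (rule transfersI)
    fix A B e e'
    assume AB: "pure_dense A" "pure_dense B"
      and sim: "sim_on (max L L') (D * D') (free_vars (Conj p q)) A B e e'"
    have "sim_on L D (free_vars p) A B e e'" "sim_on L' D' (free_vars q) A B e e'"
      using sim by (rule sim_on_mono; simp add: finite_free_vars)+
    then show "sat (sdp_struct A) e (Conj p q) \<longleftrightarrow> sat (sdp_struct B) e' (Conj p q)"
      using transfersD[OF p AB] transfersD[OF q AB] by simp
  qed
  moreover have "D * D' > 0" using D by simp
  ultimately show ?case by blast
next
  case (Ex v p)
  obtain L D where D: "D > 0" and p: "transfers L D p" using Ex.IH by blast
  define ext where "ext L' D' \<longleftrightarrow> (\<forall>A B e e' x. pure_dense A \<and> pure_dense B \<and>
     sim_on L' D' (free_vars p - {v}) A B e e' \<and> x \<in> carrier (sdp A) \<longrightarrow>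
     (\<exists>y\<in>carrier (sdp B). sim_on L D (free_vars p) A B (e(v := x)) (e'(v := y))))" for L' D'
  have "\<exists>L' D'. D' > 0 \<and> ext L' D'"
    unfolding ext_def by (rule sim_on_extend[OF D finite_free_vars])
  then obtain L' D' where D': "D' > 0" and ext: "ext L' D'" by blast
  have dir: "sat (sdp_struct B) e' (Ex v p)"
    if A: "pure_dense A" and B: "pure_dense B"
      and sim: "sim_on L' D' (free_vars (Ex v p)) A B e e'"
      and sat: "sat (sdp_struct A) e (Ex v p)" for A B e e'
  proof -
    obtain x where x: "x \<in> carrier (sdp A)" "sat (sdp_struct A) (e(v := x)) p" using sat by auto
    have "\<exists>y\<in>carrier (sdp B). sim_on L D (free_vars p) A B (e(v := x)) (e'(v := y))"
      using ext[unfolded ext_def, rule_format, of A B e e' x] A B sim x(1) by simp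
    then obtain y where y: "y \<in> carrier (sdp B)"
      "sim_on L D (free_vars p) A B (e(v := x)) (e'(v := y))" by blast
    have "sat (sdp_struct B) (e'(v := y)) p" using transfersD[OF p A B y(2)] x(2) by blast
    then show ?thesis using y(1) by auto
  qed
  have "transfers L' D' (Ex v p)"
  proof (rule transfersI)
    fix A B e e'
    assume A: "pure_dense A" and B: "pure_dense B"
      and sim: "sim_on L' D' (free_vars (Ex v p)) A B e e'"
    show "sat (sdp_struct A) e (Ex v p) \<longleftrightarrow> sat (sdp_struct B) e' (Ex v p)"
      using dir[OF A B sim] dir[OF B A sim_on_sym[OF sim]] by blast
  qed
  then show ?case using D' by blast
qed

text \<open>Without free variables \<open>sim_on\<close> holds between any two assignments and for
  all bounds, so the truth of a sentence does not depend on the group.\<close>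

lemma holds_sdp_transfer:
  assumes "pure_dense A" "pure_dense B" "sentence p" "holds (sdp_struct A) p"
  shows "holds (sdp_struct B) p"
  unfolding holds_def
proof (intro allI impI)
  fix e' :: "nat \<Rightarrow> _"
  \<comment> \<open>Any assignment into the carrier would do; it only serves to make use of
    \<open>holds\<close>.\<close>
  define e where "e = (\<lambda>_ :: nat. \<one>\<^bsub>sdp A\<^esub>)"
  have "range e \<subseteq> carrier (sdp_struct A)"
    using group.is_monoid[OF group_sdp[OF assms(1)]] by (auto simp: e_def monoid.one_closed)
  then have "sat (sdp_struct A) e p" using assms(4) unfolding holds_def by blast
  moreover have "sim_on L D (free_vars p) A B e e'" for L D
    using assms(3) by (simp add: sentence_def sim_on_def similar_empty)
  ultimately show "sat (sdp_struct B) e' p" using ex_transfers[of p] transfersD assms(1,2) by blast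
qed

end

lemma countable_sdp_carrier:
  fixes \<alpha> :: "'g \<Rightarrow> int ^ 'n ^ 'n"
  assumes "finite_int_action G \<alpha>" "countable A"
  shows "countable (carrier (finite_int_action.sdp G \<alpha> A))"
proof -
  interpret finite_int_action G \<alpha> by fact
  have "carrier (sdp A) = (UNIV \<rightarrow>\<^sub>E A) \<times> carrier G"
    by (auto simp: sdp_def)
  then show ?thesis
    using countable_PiE[OF finite, of "UNIV :: 'n set" "\<lambda>_. A"] assms(2)
      countable_finite[OF finite_carrier] by (simp add: countable_SIGMA)
qed

context finite_int_action
begin

lemma semidirect_struct_iso:
  fixes W :: "'w monoid"
  assumes "group W" "W \<cong> semidirect_int G \<alpha>"
  shows "\<exists>h. struct_iso h (struct_of_group W) (sdp_struct const_ints)"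
proof -
  obtain \<phi> where \<phi>: "\<phi> \<in> hom W (semidirect_int G \<alpha>)" "bij_betw \<phi> (carrier W) (carrier (semidirect_int G \<alpha>))"
    using assms(2) by (auto simp: is_iso_def iso_def)
  \<comment> \<open>An integer vector is read as a tuple of constant families, the diagonal copy of
    the integers.\<close>
  define \<psi> :: "(int ^ 'n) \<times> 'g \<Rightarrow> ('n \<Rightarrow> nat \<Rightarrow> rat) \<times> 'g" where
    "\<psi> = (\<lambda>(a, w). (\<lambda>i p. of_int (a $ i), w))"
  have \<psi>_mult: "\<psi> (x \<otimes>\<^bsub>semidirect_int G \<alpha>\<^esub> y) = \<psi> x \<otimes>\<^bsub>sdp const_ints\<^esub> \<psi> y" for x y
    by (auto simp: \<psi>_def semidirect_int_def sdp_simps act_apply matrix_vector_mult_def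
        split: prod.splits)
  have "bij_betw \<psi> (carrier (semidirect_int G \<alpha>)) (carrier (sdp const_ints))"
    unfolding bij_betw_def
  proof
    show "inj_on \<psi> (carrier (semidirect_int G \<alpha>))"
      by (auto simp: inj_on_def \<psi>_def fun_eq_iff vec_eq_iff)
    show "\<psi> ` carrier (semidirect_int G \<alpha>) = carrier (sdp const_ints)"
    proof (intro equalityI subsetI)
      fix z assume "z \<in> \<psi> ` carrier (semidirect_int G \<alpha>)"
      then show "z \<in> carrier (sdp const_ints)"
        by (auto simp: \<psi>_def semidirect_int_def sdp_simps const_ints_def)
    next
      fix z assume z: "z \<in> carrier (sdp const_ints)"
      obtain x w where xw: "z = (x, w)" by fastforce
      have "\<forall>i. \<exists>n. x i = (\<lambda>p. of_int n)" using z by (auto simp: xw sdp_simps const_ints_def)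
      then obtain n where "\<And>i. x i = (\<lambda>p. of_int (n i))" by metis
      then have "z = \<psi> (\<chi> i. n i, w)" by (simp add: xw \<psi>_def fun_eq_iff)
      moreover have "(\<chi> i. n i, w) \<in> carrier (semidirect_int G \<alpha>)"
        using z by (simp add: xw sdp_simps semidirect_int_def)
      ultimately show "z \<in> \<psi> ` carrier (semidirect_int G \<alpha>)" by (rule image_eqI)
    qed
  qed
  then have bij: "bij_betw (\<psi> \<circ> \<phi>) (carrier W) (carrier (sdp const_ints))"
    using \<phi>(2) bij_betw_trans by blast
  have mult: "(\<psi> \<circ> \<phi>) (x \<otimes>\<^bsub>W\<^esub> y) = (\<psi> \<circ> \<phi>) x \<otimes>\<^bsub>sdp const_ints\<^esub> (\<psi> \<circ> \<phi>) y"
    if "x \<in> carrier W" "y \<in> carrier W" for x y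
    using hom_mult[OF \<phi>(1) that] \<psi>_mult by simp
  have hom: "\<psi> \<circ> \<phi> \<in> hom W (sdp const_ints)"
    using mult bij by (auto simp: hom_def bij_betw_def)
  have grp: "group (sdp const_ints)" using group_sdp[OF pure_dense_const_ints] .
  \<comment> \<open>Provides preservation of unit and inverses, which \<open>struct_iso\<close>
    demands in addition to products.\<close>
  interpret group_hom W "sdp const_ints" "\<psi> \<circ> \<phi>"
    using assms(1) grp hom by (simp add: group_hom_def group_hom_axioms_def)
  have "struct_iso (\<psi> \<circ> \<phi>) (struct_of_group W) (sdp_struct const_ints)"
    unfolding struct_iso_def struct_of_group_simps using bij mult hom_one hom_inv by blast
  then show ?thesis by blast
qed

section \<open>Powers and roots in the two structures\<close>

lemma sdp_pow_translation:
  "(y, \<one>) [^]\<^bsub>sdp A\<^esub> (m :: nat) = (\<lambda>i p. of_nat m * y i p, \<one>)"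
proof (induction m)
  case (Suc m)
  then show ?case by (simp add: nat_pow_def sdp_simps act_one algebra_simps)
qed (simp add: nat_pow_def sdp_simps)

lemma snd_sdp_pow:
  "snd (x [^]\<^bsub>sdp A\<^esub> (m :: nat)) = snd x [^] m"
proof (induction m)
  case (Suc m)
  then show ?case
    by (cases x; cases "x [^]\<^bsub>sdp A\<^esub> m") (simp add: nat_pow_def sdp_simps)
qed (simp add: nat_pow_def sdp_simps)

text \<open>By Lagrange the finite part dies in the power \<open>order G\<close>, so a translation
  remains.\<close>

lemma sdp_pow_order:
  assumes "pure_dense A" "x \<in> carrier (sdp A)"
  shows "\<exists>y. (\<forall>i. y i \<in> A) \<and> x [^]\<^bsub>sdp A\<^esub> order G = (y, \<one>)"
proof -
  have "snd x \<in> carrier G" using assms(2) by (cases x) (simp add: sdp_simps)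
  then have "snd (x [^]\<^bsub>sdp A\<^esub> order G) = \<one>" by (simp add: snd_sdp_pow pow_order_eq_1)
  then obtain y where y: "x [^]\<^bsub>sdp A\<^esub> order G = (y, \<one>)" by (metis prod.collapse)
  moreover have "x [^]\<^bsub>sdp A\<^esub> order G \<in> carrier (sdp A)"
    using group_sdp[OF assms(1)] assms(2) by (simp add: group_def monoid.nat_pow_closed)
  ultimately show ?thesis by (auto simp: sdp_simps)
qed

text \<open>A root \<open>z\<close> need not be a translation itself, so both sides are raised to
  the power \<open>order G\<close> once more. Comparing a nonzero coordinate n then gives m * c =
  order G * n for an integer c.\<close>

lemma no_root_const_ints:
  assumes x: "x \<in> carrier (sdp const_ints)" "x [^]\<^bsub>sdp const_ints\<^esub> order G \<noteq> \<one>\<^bsub>sdp const_ints\<^esub>"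
  shows "\<exists>N. \<forall>m > N. \<forall>z\<in>carrier (sdp const_ints).
    z [^]\<^bsub>sdp const_ints\<^esub> (m :: nat) \<noteq> x [^]\<^bsub>sdp const_ints\<^esub> order G"
proof -
  obtain y where y: "\<And>i. y i \<in> const_ints" "x [^]\<^bsub>sdp const_ints\<^esub> order G = (y, \<one>)"
    using sdp_pow_order[OF pure_dense_const_ints x(1)] by blast
  then obtain i p where ip: "y i p \<noteq> 0" using x(2) by (auto simp: sdp_simps fun_eq_iff)
  obtain n where n: "y i = (\<lambda>p. of_int n)" using y(1)[of i] by (auto simp: const_ints_def)
  have "n \<noteq> 0" using ip n by auto
  have "order G > 0" using finite_carrier by (simp add: order_gt_0_iff_finite)
  show ?thesis
  \<comment> \<open>\<open>m\<close> divides the nonzero integer order G * n and so cannot exceed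
    its absolute value.\<close>
  proof (intro exI[of _ "nat \<bar>int (order G) * n\<bar>"] allI impI ballI notI)
    fix m z assume m: "nat \<bar>int (order G) * n\<bar> < m" and z: "z \<in> carrier (sdp const_ints)"
      and eq: "z [^]\<^bsub>sdp const_ints\<^esub> m = x [^]\<^bsub>sdp const_ints\<^esub> order G"
    obtain b where b: "\<And>i. b i \<in> const_ints" "z [^]\<^bsub>sdp const_ints\<^esub> order G = (b, \<one>)"
      using sdp_pow_order[OF pure_dense_const_ints z] by blast
    have "(z [^]\<^bsub>sdp const_ints\<^esub> order G) [^]\<^bsub>sdp const_ints\<^esub> m
        = (z [^]\<^bsub>sdp const_ints\<^esub> m) [^]\<^bsub>sdp const_ints\<^esub> order G"
      using group.pow_pow_swap[OF group_sdp[OF pure_dense_const_ints] z] .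
    then have "of_nat m * b i p = of_nat (order G) * y i p"
      by (simp add: b(2) eq y(2) sdp_pow_translation fun_eq_iff)
    moreover obtain c where "b i = (\<lambda>p. of_int c)" using b(1)[of i] by (auto simp: const_ints_def)
    ultimately have "(of_int (int m * c) :: rat) = of_int (int (order G) * n)" by (simp add: n)
    then have "int m * c = int (order G) * n" using of_int_eq_iff by blast
    then have "int m dvd int (order G) * n" by (metis dvd_triv_left)
    moreover have "int (order G) * n \<noteq> 0" using \<open>n \<noteq> 0\<close> \<open>order G > 0\<close> by simp
    ultimately have "\<bar>int m\<bar> \<le> \<bar>int (order G) * n\<bar>" by (intro dvd_imp_le_int)
    then show False using m by linarith
  qed
qed

text \<open>A prime beyond the support is a unit in each localization where the vector is nonzero,
  so the vector can be divided by it componentwise.\<close>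

lemma roots_fin_supp:
  assumes x: "x \<in> carrier (sdp fin_supp)"
  shows "\<exists>m > N. \<exists>z\<in>carrier (sdp fin_supp). z [^]\<^bsub>sdp fin_supp\<^esub> (m :: nat) = x [^]\<^bsub>sdp fin_supp\<^esub> order G"
proof -
  obtain y where y: "\<And>i. y i \<in> fin_supp" "x [^]\<^bsub>sdp fin_supp\<^esub> order G = (y, \<one>)"
    using sdp_pow_order[OF pure_dense_fin_supp x] by blast
  have "finite (\<Union>i. {p. y i p \<noteq> 0})" using y(1) by (simp add: fin_supp_def)
  then obtain N' where N': "\<And>i p. y i p \<noteq> 0 \<Longrightarrow> p < N'"
    unfolding finite_nat_set_iff_bounded by blast
  obtain m where m: "prime m" "m > max N N'" using bigger_prime by blast
  define z where "z = (\<lambda>i p. y i p / of_nat m)"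
  have "z i \<in> fin_supp" for i
  proof -
    have "z i p \<in> localized_int p" if p: "prime p" for p
    proof (cases "y i p = 0")
      case True
      then show ?thesis using localized_int_of_int[OF p, of 0] by (simp add: z_def)
    next
      case False
      then have "p < m" using N'[of i p] m(2) by simp
      then have "\<not> p dvd m" using primes_dvd_imp_eq[OF p m(1)] by blast
      then show ?thesis
        using localized_int_divide[OF p] y(1)[of i] p by (simp add: z_def fin_supp_def loc_prod_def)
    qed
    moreover have "{p. z i p \<noteq> 0} \<subseteq> {p. y i p \<noteq> 0}" by (auto simp: z_def)
    ultimately show ?thesis
      using y(1)[of i] finite_subset by (auto simp: fin_supp_def loc_prod_def)
  qed
  then have "(z, \<one>) \<in> carrier (sdp fin_supp)" by (simp add: sdp_simps)
  moreover have "(z, \<one>) [^]\<^bsub>sdp fin_supp\<^esub> m = (y, \<one>)"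
    using m(1) by (auto simp: sdp_pow_translation z_def)
  ultimately show ?thesis using m(2) y(2) by (metis max_less_iff_conj)
qed

end

theorem theorem1p3:
  fixes W\<^sub>0 :: "'g monoid"
    and \<alpha> :: "'g \<Rightarrow> int ^ 'n ^ 'n"
    and W :: "'w monoid"
  assumes "group W\<^sub>0" and "finite (carrier W\<^sub>0)"
    and "\<alpha> \<in> hom W\<^sub>0 GL_int" and "inj_on \<alpha> (carrier W\<^sub>0)"
    and "group W" and "W \<cong> semidirect_int W\<^sub>0 \<alpha>"
    and "infinite (UNIV :: 'u set)"
  shows "\<not> (\<exists>M :: 'm gstruct. prime_model TYPE('u) (Th (struct_of_group W)) M)"
proof
  assume "\<exists>M :: 'm gstruct. prime_model TYPE('u) (Th (struct_of_group W)) M"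
  then obtain M :: "'m gstruct" where M: "prime_model TYPE('u) (Th (struct_of_group W)) M" by blast
  interpret finite_int_action W\<^sub>0 \<alpha>
    using assms(1-3) by (simp add: finite_int_action_def finite_int_action_axioms_def)
  define T where "T = Th (struct_of_group W)"
  define k where "k = order W\<^sub>0"
  obtain h where h: "struct_iso h (struct_of_group W) (sdp_struct const_ints)"
    using semidirect_struct_iso[OF assms(5,6)] by blast
  have holds_W: "holds (sdp_struct const_ints) p \<longleftrightarrow> holds (struct_of_group W) p" for p
    using holds_struct_iso[OF is_struct_of_group[OF assms(5)] h] .
  have model: "is_model (sdp_struct A) T" if "pure_dense A" for A
    unfolding is_model_def T_def Th_def
    using is_struct_of_group[OF group_sdp[OF that]] holds_W
      holds_sdp_transfer[OF pure_dense_const_ints that] by blast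
  have fia: "finite_int_action W\<^sub>0 \<alpha>" by unfold_locales
  obtain f where f: "elementary_embedding f M (sdp_struct const_ints)"
    using prime_model_embeds[OF M _ _ assms(7)] model[OF pure_dense_const_ints] T_def
      countable_sdp_carrier[OF fia countable_const_ints] by fastforce
  obtain g where g: "elementary_embedding g M (sdp_struct fin_supp)"
    using prime_model_embeds[OF M _ _ assms(7)] model[OF pure_dense_fin_supp] T_def
      countable_sdp_carrier[OF fia countable_fin_supp] by fastforce
  have k: "k > 0" using assms(2) by (simp add: k_def order_gt_0_iff_finite)
  \<comment> \<open>The formula picks out an element of \<open>M\<close> on which the two embeddings
    will disagree about \<open>root\<close>; the word is x^k so that its value is a
    translation.\<close>
  define nontriv where "nontriv = Neg (Eq (pow_term (Var 0) k) One)"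
  define root where "root = (\<lambda>m. Ex 1 (Eq (pow_term (Var 1) m) (pow_term (Var 0) k)))"
  have sat_root: "sat (sdp_struct A) e (root m) \<longleftrightarrow>
      (\<exists>z\<in>carrier (sdp A). z [^]\<^bsub>sdp A\<^esub> m = e 0 [^]\<^bsub>sdp A\<^esub> k)" for A e m
    by (simp add: root_def term_val_pow_term)
  have sat_nontriv: "sat (sdp_struct A) e nontriv \<longleftrightarrow> e 0 [^]\<^bsub>sdp A\<^esub> k \<noteq> \<one>\<^bsub>sdp A\<^esub>" for A e
    by (simp add: nontriv_def term_val_pow_term)
  have "sentence (Ex 0 nontriv)"
    using term_vars_pow_term[of "Var 0" k] by (auto simp: sentence_def nontriv_def)
  moreover have "holds (sdp_struct const_ints) (Ex 0 nontriv)"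
    unfolding holds_def
  proof (intro allI impI)
    fix e :: "nat \<Rightarrow> ('n \<Rightarrow> nat \<Rightarrow> rat) \<times> 'g"
    \<comment> \<open>Translation by the all-ones vector; its k-th power is translation by k, and k
      is positive.\<close>
    let ?a = "(\<lambda>i p. 1, \<one>\<^bsub>W\<^sub>0\<^esub>) :: ('n \<Rightarrow> nat \<Rightarrow> rat) \<times> 'g"
    have "(\<lambda>p. 1) \<in> const_ints" unfolding const_ints_def by (rule image_eqI[of _ _ 1]) auto
    then have a: "?a \<in> carrier (sdp const_ints)" by (simp add: sdp_simps)
    have "sat (sdp_struct const_ints) (e(0 := ?a)) nontriv"
      using k unfolding sat_nontriv by (simp add: sdp_pow_translation sdp_simps fun_eq_iff)
    then show "sat (sdp_struct const_ints) e (Ex 0 nontriv)" using a by auto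
  qed
  ultimately have "Ex 0 nontriv \<in> Th (struct_of_group W)" using holds_W by (simp add: Th_def)
  then have "holds M (Ex 0 nontriv)" using M by (simp add: prime_model_def is_model_def)
  moreover have one: "\<one>\<^bsub>M\<^esub> \<in> carrier M" using M by (simp add: prime_model_def is_model_def is_struct_def)
  ultimately have "sat M (\<lambda>_. \<one>\<^bsub>M\<^esub>) (Ex 0 nontriv)" unfolding holds_def by auto
  then obtain x where x: "x \<in> carrier M" "sat M ((\<lambda>_. \<one>\<^bsub>M\<^esub>)(0 := x)) nontriv" by auto
  \<comment> \<open>Assignments are total, so the other variables receive the unit as a value inside
    the carrier.\<close>
  define e :: "nat \<Rightarrow> 'm" where "e = (\<lambda>_. \<one>\<^bsub>M\<^esub>)(0 := x)"
  have e: "range e \<subseteq> carrier M" "e 0 = x" using x(1) one by (auto simp: e_def)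
  have fe: "sat M e p \<longleftrightarrow> sat (sdp_struct const_ints) (f \<circ> e) p"
    and ge: "sat M e p \<longleftrightarrow> sat (sdp_struct fin_supp) (g \<circ> e) p" for p
    using f g e(1) by (simp_all add: elementary_embedding_def)
  have mem: "f x \<in> carrier (sdp const_ints)" "g x \<in> carrier (sdp fin_supp)"
    using f g x(1) by (auto simp: elementary_embedding_def)
  have "f x [^]\<^bsub>sdp const_ints\<^esub> k \<noteq> \<one>\<^bsub>sdp const_ints\<^esub>"
    using x(2) fe[of nontriv] unfolding e_def[symmetric] sat_nontriv by (simp add: e(2))
  \<comment> \<open>Whether x^k has an m-th root is a property of \<open>x\<close> in
    \<open>M\<close>. The first embedding denies it for all m > N, and the second affirms it for
    some such m.\<close>
  then obtain N where N: "\<And>m. m > N \<Longrightarrow> \<not> sat M e (root m)"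
    using no_root_const_ints[OF mem(1)] unfolding fe sat_root k_def comp_apply e(2) by blast
  obtain m where "m > N" "sat M e (root m)"
    using roots_fin_supp[OF mem(2), of N] unfolding ge sat_root k_def comp_apply e(2) by blast
  then show False using N by blast
qed

end
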